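(* Let $\widetilde{G}$ be a mixed graph with underlying graph $G$. Then $rk(\widetilde{G})-r(G)=2d(G)$ if and only if all of the following hold: (i) the mixed cycles (if any) of $\widetilde{G}$ are pairwise vertex-disjoint; (ii) for each mixed cycle $\widetilde{C}_l$ of $\widetilde{G}$ (of length $l$), $l\equiv 0\pmod 4$ and either $\eta(\widetilde{C}_l)$ is odd or $\eta(\widetilde{C}_l)\equiv 2\pmod 4$; (iii) a series of $\delta$-transformations can switch $G$ to a crucial subgraph which is the disjoint union of $d(G)$ cycles together with some isolated vertices.
   Context: All graphs are finite and simple. A mixed graph $\widetilde{G}$ is obtained from a simple graph $G$ (its underlying graph) by orienting some of its edges. The Hermitian adjacency matrix $H(\widetilde{G})=(h_{uv})$ has $h_{uv}=1$ for an undirected edge $\{u,v\}$, $h_{uv}=i$ for an arc $(u,v)$, $h_{uv}=-i$ for an arc $(v,u)$, $0$ otherwise; $rk(\widetilde{G})$ is its rank and $r(G)$ is the rank of the adjacency matrix of $G$. $d(G)=|E_G|-|V_G|+\omega(G)$ with $\omega(G)$ the number of components. A mixed cycle of $\widetilde{G}$ is a cycle of $G$ with the orientations/non-orientations its edges have in $\widetilde{G}$. The signature $\eta(\widetilde{C})$ of a mixed cycle is $|f-b|$, where, traversing the cycle in one direction, $f$ is the number of arcs oriented forward and $b$ the number oriented backward (undirected edges are not counted). A pendant vertex is a vertex of degree one. A $\delta$-transformation on a graph with a pendant vertex deletes a pendant vertex together with its neighbour. For a graph whose cycles are pairwise vertex-disjoint, one repeatedly applies $\delta$-transformations until an induced subgraph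 without pendant vertices is obtained; this resulting induced subgraph is called a crucial subgraph. *)

theory Defs
  imports "HOL-Analysis.Analysis" "HOL-Number_Theory.Cong"
begin

definition simple_graph :: "'v set \<Rightarrow> 'v set set \<Rightarrow> bool" where
  "simple_graph V E \<longleftrightarrow> finite V \<and> (\<forall>e\<in>E. e \<subseteq> V \<and> card e = 2)"

text \<open>A mixed graph is given by its underlying graph \<open>(V, E)\<close> and the set \<open>A\<close> of arcs; the edges
  of \<open>E\<close> carrying no arc are the undirected ones.\<close>

definition mixed_graph :: "'v set \<Rightarrow> 'v set set \<Rightarrow> ('v \<times> 'v) set \<Rightarrow> bool" where
  "mixed_graph V E A \<longleftrightarrow>
     simple_graph V E \<and> (\<forall>u v. (u, v) \<in> A \<longrightarrow> {u, v} \<in> E \<and> (v, u) \<notin> A)"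

definition adjacency_matrix :: "'v set set \<Rightarrow> real ^ 'v ^ ('v::finite)" where
  "adjacency_matrix E = (\<chi> u v. if {u, v} \<in> E then 1 else 0)"

definition hermitian_adjacency_matrix ::
    "'v set set \<Rightarrow> ('v \<times> 'v) set \<Rightarrow> complex ^ 'v ^ ('v::finite)" where
  "hermitian_adjacency_matrix E A =
     (\<chi> u v. if (u, v) \<in> A then \<i> else if (v, u) \<in> A then - \<i>
             else if {u, v} \<in> E then 1 else 0)"

definition same_component :: "'v set \<Rightarrow> 'v set set \<Rightarrow> ('v \<times> 'v) set" where
  "same_component V E = {(u, v). u \<in> V \<and> v \<in> V \<and> (u, v) \<in> {(x, y). {x, y} \<in> E}\<^sup>*}"

definition num_components :: "'v set \<Rightarrow> 'v set set \<Rightarrow> nat" where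
  "num_components V E = card (V // same_component V E)"

definition cyclomatic_number :: "'v set \<Rightarrow> 'v set set \<Rightarrow> int" where
  "cyclomatic_number V E = int (card E) - int (card V) + int (num_components V E)"

text \<open>A cycle is presented by the list of its vertices in the order of a traversal. Different
  lists (rotations and reversals) present the same cycle; as a subgraph, the cycle is determined
  by its edge set \<open>cycle_edges xs\<close>.\<close>

definition cycle_next :: "'v list \<Rightarrow> nat \<Rightarrow> 'v" where
  "cycle_next xs i = xs ! (Suc i mod length xs)"

definition cycle_edges :: "'v list \<Rightarrow> 'v set set" where
  "cycle_edges xs = {{xs ! i, cycle_next xs i} | i. i < length xs}"

definition is_cycle :: "'v set set \<Rightarrow> 'v list \<Rightarrow> bool" where
  "is_cycle E xs \<longleftrightarrow> length xs \<ge> 3 \<and> distinct xs \<and> cycle_edges xs \<subseteq> E"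

definition cycles_vertex_disjoint :: "'v set set \<Rightarrow> bool" where
  "cycles_vertex_disjoint E \<longleftrightarrow>
     (\<forall>xs ys. is_cycle E xs \<longrightarrow> is_cycle E ys \<longrightarrow> cycle_edges xs \<noteq> cycle_edges ys
        \<longrightarrow> set xs \<inter> set ys = {})"

definition forward_arcs :: "('v \<times> 'v) set \<Rightarrow> 'v list \<Rightarrow> nat" where
  "forward_arcs A xs = card {i. i < length xs \<and> (xs ! i, cycle_next xs i) \<in> A}"

definition backward_arcs :: "('v \<times> 'v) set \<Rightarrow> 'v list \<Rightarrow> nat" where
  "backward_arcs A xs = card {i. i < length xs \<and> (cycle_next xs i, xs ! i) \<in> A}"

definition signature :: "('v \<times> 'v) set \<Rightarrow> 'v list \<Rightarrow> nat" where
  "signature A xs = nat \<bar>int (forward_arcs A xs) - int (backward_arcs A xs)\<bar>"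

definition induced_edges :: "'v set set \<Rightarrow> 'v set \<Rightarrow> 'v set set" where
  "induced_edges E W = {e \<in> E. e \<subseteq> W}"

definition pendant_vertex :: "'v set \<Rightarrow> 'v set set \<Rightarrow> 'v \<Rightarrow> bool" where
  "pendant_vertex V E x \<longleftrightarrow> x \<in> V \<and> card {y. {x, y} \<in> E} = 1"

text \<open>All graphs met while transforming \<open>(V, E)\<close> are induced subgraphs of it, hence are
  represented by their vertex sets.\<close>

inductive delta_transformation :: "'v set set \<Rightarrow> 'v set \<Rightarrow> 'v set \<Rightarrow> bool"
  for E :: "'v set set" where
  "\<lbrakk>pendant_vertex W (induced_edges E W) x; {x, y} \<in> induced_edges E W\<rbrakk>
     \<Longrightarrow> delta_transformation E W (W - {x, y})"

definition crucial_subgraph :: "'v set \<Rightarrow> 'v set set \<Rightarrow> 'v set \<Rightarrow> bool" where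
  "crucial_subgraph V E W \<longleftrightarrow>
     (delta_transformation E)\<^sup>*\<^sup>* V W \<and> \<not> (\<exists>x. pendant_vertex W (induced_edges E W) x)"

text \<open>The set \<open>I\<close> of isolated vertices may be empty.\<close>

definition disjoint_cycles_and_isolated :: "'v set \<Rightarrow> 'v set set \<Rightarrow> int \<Rightarrow> bool" where
  "disjoint_cycles_and_isolated V E k \<longleftrightarrow>
     (\<exists>C I. finite C \<and> int (card C) = k
        \<and> (\<forall>xs\<in>C. is_cycle E xs)
        \<and> pairwise (\<lambda>xs ys. disjnt (set xs) (set ys)) C
        \<and> disjnt (\<Union>(set ` C)) I
        \<and> V = \<Union>(set ` C) \<union> I
        \<and> E = \<Union>(cycle_edges ` C))"

end

theory Submission
  imports Defs
begin

text \<open>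
  For an induced subgraph \<open>X\<close> let the gap be the nullity of the adjacency matrix minus that of the
  Hermitian matrix, and \<open>d\<close> the cyclomatic number. Deleting a vertex changes the gap by at most two and,
  if the vertex lies on a cycle, lowers \<open>d\<close>; deleting a pendant vertex with its neighbour keeps both
  nullities. Induction gives \<open>gap \<le> 2 d\<close>, and a tight \<open>X\<close> (equality) stays tight under both deletions.
  Tightness forces \<open>d\<close> to drop by exactly one at every cycle vertex, so cycles sharing a vertex
  coincide, and forces the neighbour of a pendant vertex off the cycles.

  The main point is that a tight graph without pendant vertices has no edge outside its cycles.
  Otherwise some cycle \<open>C\<close> is joined to the rest by a single edge at a vertex \<open>v\<close>. By induction
  the length of \<open>C\<close> is even, so \<open>C - v\<close> is a path of odd order and contributes one to the nullity of
  \<open>X - v\<close>, which equals that of \<open>X - p\<close> for the successor \<open>p\<close> of \<open>v\<close> on \<open>C\<close>. In \<open>X - p\<close>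
  the non-cyclic vertices then form a vertex cover \<open>Y\<close> of the non-cyclic edges and a strictly larger
  independent set \<open>B\<close>, all but one of whose members have degree at least two; so many edges at \<open>B\<close>
  contain a cycle, a contradiction. The remaining case of disjoint cycles is settled by solving the
  null equations around a cycle, where the product of the edge weights is a power of \<open>\<i>\<close> given by
  the signature.
\<close>

section \<open>Nullity of principal submatrices\<close>

text \<open>Counting \<open>d\<close> alone does not exclude an edge joining two cycles; what
  excludes it is the nullity of the real matrix. At a cycle vertex of a tight graph the gap falls by
  two, the most that two nullities moving by one each allow, so the nullity of the adjacency matrix
  falls by exactly one, whichever cycle vertex is deleted. This is why \<open>X - v\<close> and
  \<open>X - p\<close> are comparable. They serve different purposes: \<open>X - v\<close> falls
  apart into a path and the rest, so its nullity can be read off, whereas \<open>X - p\<close> is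
  good for counting degrees. Deleting \<open>v\<close> would cost each of its two cycle neighbours
  and its outside neighbour an edge; deleting \<open>p\<close> leaves \<open>v\<close> with two
  neighbours, so only the other cycle neighbour of \<open>p\<close> may drop to degree one. This is
  the exceptional member of \<open>B\<close>. The even length of \<open>C\<close> uses a second
  cycle on the other side of the bridge: deleting one of its vertices gives a smaller tight graph
  that still contains \<open>C\<close>. Hence tightness of the cycles, the covering and the absence
  of bridges are proved in one induction.\<close>

lemma dim_functional_kernel:
  fixes S :: "('a::field ^ 'n) set" and \<phi> :: "'a ^ 'n \<Rightarrow> 'a"
  assumes S: "vec.subspace S"
    and add: "\<And>x y. \<phi> (x + y) = \<phi> x + \<phi> y" and scale: "\<And>c x. \<phi> (c *s x) = c * \<phi> x"
    and s: "s \<in> S" "\<phi> s \<noteq> 0"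
  shows "vec.dim S = Suc (vec.dim {x \<in> S. \<phi> x = 0})"
proof -
  let ?T = "{x \<in> S. \<phi> x = 0}"
  have z: "\<phi> 0 = 0" using scale[of 0 0] by simp
  have T: "vec.subspace ?T"
    using S by (auto simp: vec.subspace_def add scale z)
  have sT: "s \<notin> vec.span ?T"
    using s(2) unfolding vec.span_eq_iff[THEN iffD2, OF T] by simp
  have "S \<subseteq> vec.span (insert s ?T)"
  proof
    fix x assume x: "x \<in> S"
    define c where "c = \<phi> x / \<phi> s"
    have "\<phi> (x - c *s s) = 0"
    proof -
      have "\<phi> x = \<phi> (x - c *s s) + \<phi> (c *s s)" by (metis add diff_add_cancel)
      then show ?thesis using s(2) by (simp add: scale c_def)
    qed
    moreover have "x - c *s s \<in> S"
      using x s(1) S by (simp add: vec.subspace_diff vec.subspace_scale)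
    ultimately have "x - c *s s \<in> vec.span ?T" by (simp add: vec.span_base)
    then show "x \<in> vec.span (insert s ?T)" unfolding vec.span_insert by blast
  qed
  moreover have "insert s ?T \<subseteq> S" using s by auto
  ultimately have "vec.dim S = vec.dim (insert s ?T)"
    using vec.dim_subset[of S "vec.span (insert s ?T)"] vec.dim_subset[of "insert s ?T" S]
    unfolding vec.dim_span by linarith
  then show ?thesis using sT by (simp add: vec.dim_insert)
qed

corollary dim_functional_kernel_le:
  fixes S :: "('a::field ^ 'n) set" and \<phi> :: "'a ^ 'n \<Rightarrow> 'a"
  assumes S: "vec.subspace S"
    and add: "\<And>x y. \<phi> (x + y) = \<phi> x + \<phi> y" and scale: "\<And>c x. \<phi> (c *s x) = c * \<phi> x"
  shows "vec.dim S \<le> Suc (vec.dim {x \<in> S. \<phi> x = 0})"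
proof (cases "\<exists>s\<in>S. \<phi> s \<noteq> 0")
  case True
  then show ?thesis using dim_functional_kernel[OF S add scale] by force
next
  case False
  then have "{x \<in> S. \<phi> x = 0} = S" by auto
  then show ?thesis by simp
qed

text \<open>Independence allows a linear map that kills \<open>B\<close> but not \<open>b\<close>;
  its values on the unit vectors are the entries of \<open>z\<close>.\<close>

lemma dual_vector_exists:
  fixes B :: "('a::field ^ 'n) set"
  assumes "vec.independent (insert b B)" "b \<notin> B"
  shows "\<exists>z. (\<forall>r\<in>B. (\<Sum>i\<in>UNIV. r$i * z$i) = 0) \<and> (\<Sum>i\<in>UNIV. b$i * z$i) \<noteq> 0"
proof -
  \<comment> \<open>The extension lemma is applied with vector-valued maps, so the functional is
    stored in one arbitrary coordinate \<open>k0\<close>.\<close>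
  fix k0 :: 'n
  obtain g where g: "Vector_Spaces.linear (*s) (*s) g"
     "\<forall>x\<in>insert b B. g x = (if x = b then axis k0 (1::'a) else (0::'a^'n))"
    using vec.linear_independent_extend[OF assms(1), of "\<lambda>x. if x = b then axis k0 (1::'a) else (0::'a^'n)"]
    by (elim exE conjE)
  define z where "z = (\<chi> i. g (axis i 1) $ k0)"
  have rep: "g x $ k0 = (\<Sum>i\<in>UNIV. x$i * z$i)" for x
  proof -
    have "g x = g (\<Sum>i\<in>UNIV. x$i *s axis i 1)" by (simp add: basis_expansion)
    also have "\<dots> = (\<Sum>i\<in>UNIV. x$i *s g (axis i 1))"
      unfolding vec.linear_sum[OF g(1)] vec.linear_scale[OF g(1)] ..
    finally show ?thesis by (simp add: z_def)
  qed
  show ?thesis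
  proof (intro exI[of _ z] conjI ballI)
    fix r assume "r \<in> B"
    then have "g r = 0" using g(2) assms(2) by auto
    then show "(\<Sum>i\<in>UNIV. r$i * z$i) = 0" using rep[of r] by simp
  next
    have "g b = axis k0 1" using g(2) by auto
    then show "(\<Sum>i\<in>UNIV. b$i * z$i) \<noteq> 0" using rep[of b] by simp
  qed
qed

text \<open>Each further independent vector imposes an equation that does not vanish on the
  solutions of the earlier ones, by the dual vector, so it costs exactly one dimension.\<close>

lemma dim_orthogonal_independent:
  fixes B :: "('a::field ^ 'n) set"
  assumes "finite B" "vec.independent B"
  shows "vec.dim {z. \<forall>r\<in>B. (\<Sum>i\<in>UNIV. r$i * z$i) = 0} + card B = CARD('n)"
  using assms
proof (induction B rule: finite_induct)
  case empty
  then show ?case by (simp add: card_cart_basis)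
next
  case (insert b B)
  let ?S = "{z. \<forall>r\<in>B. (\<Sum>i\<in>UNIV. r$i * z$i) = 0}"
  let ?p = "\<lambda>z. \<Sum>i\<in>UNIV. b$i * z$i"
  have sub: "vec.subspace ?S"
    by (auto simp: vec.subspace_def algebra_simps sum.distrib simp flip: sum_distrib_left)
  obtain z where z: "z \<in> ?S" "?p z \<noteq> 0"
    using dual_vector_exists[OF insert.prems insert.hyps(2)] by blast
  have "vec.dim ?S = Suc (vec.dim {x \<in> ?S. ?p x = 0})"
    by (rule dim_functional_kernel[where s = z, OF sub])
       (use z in \<open>simp_all add: algebra_simps sum.distrib sum_distrib_left\<close>)
  moreover have "{x \<in> ?S. ?p x = 0} = {z. \<forall>r\<in>insert b B. (\<Sum>i\<in>UNIV. r$i * z$i) = 0}" by auto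
  moreover have "vec.dim ?S + card B = CARD('n)"
    using insert vec.independent_mono by blast
  ultimately show ?case using insert.hyps by simp
qed

text \<open>This is the kernel of the principal submatrix on \<open>X\<close>, padded with zeros.
  All these kernels live in one ambient space, so kernels for different vertex sets can be compared
  by inclusion.\<close>

definition null_space_on :: "'a::field ^ 'v ^ 'v \<Rightarrow> 'v set \<Rightarrow> ('a ^ 'v::finite) set" where
  "null_space_on M X =
     {z. (\<forall>u. u \<notin> X \<longrightarrow> z$u = 0) \<and> (\<forall>u\<in>X. (\<Sum>v\<in>UNIV. M$u$v * z$v) = 0)}"

definition nullity_on :: "'a::field ^ 'v ^ 'v \<Rightarrow> ('v::finite) set \<Rightarrow> nat" where
  "nullity_on M X = vec.dim (null_space_on M X)"

lemma rank_plus_nullity: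
  fixes M :: "'a::field ^ 'v ^ ('v::finite)"
  shows "rank M + nullity_on M UNIV = CARD('v)"
proof -
  obtain B where B: "B \<subseteq> rows M" "vec.independent B" "rows M \<subseteq> vec.span B" "card B = vec.dim (rows M)"
    using vec.basis_exists[of "rows M"] by metis
  have fB: "finite B" using B(2) vec.finiteI_independent by blast
  have "null_space_on M UNIV = {z. \<forall>r\<in>rows M. (\<Sum>i\<in>UNIV. r$i * z$i) = 0}"
    by (auto simp: null_space_on_def rows_def row_def)
  also have "\<dots> = {z. \<forall>r\<in>B. (\<Sum>i\<in>UNIV. r$i * z$i) = 0}"
  proof (intro equalityI subsetI)
    fix z assume z: "z \<in> {z. \<forall>r\<in>B. (\<Sum>i\<in>UNIV. r$i * z$i) = 0}"
    have "vec.subspace {r. (\<Sum>i\<in>UNIV. r$i * z$i) = 0}"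
      by (auto simp: vec.subspace_def algebra_simps sum.distrib simp flip: sum_distrib_left)
    then have "vec.span B \<subseteq> {r. (\<Sum>i\<in>UNIV. r$i * z$i) = 0}"
      by (intro vec.span_minimal) (use z in auto)
    then show "z \<in> {z. \<forall>r\<in>rows M. (\<Sum>i\<in>UNIV. r$i * z$i) = 0}" using B(3) by blast
  qed (use B(1) in auto)
  finally show ?thesis
    using dim_orthogonal_independent[OF fB B(2)] B(4)
    by (simp add: nullity_on_def row_rank_def_gen)
qed

lemma subspace_null_space_on: "vec.subspace (null_space_on M X)"
  by (auto simp: null_space_on_def vec.subspace_def algebra_simps sum.distrib simp flip: sum_distrib_left)

text \<open>Both null spaces cut down by one linear equation give the same space, the vectors of
  the smaller null space that satisfy the equation of row \<open>v\<close>.\<close>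

lemma null_space_on_remove:
  assumes "v \<in> X"
  shows "{z \<in> null_space_on M X. z$v = 0} =
    {z \<in> null_space_on M (X - {v}). (\<Sum>u\<in>UNIV. M$v$u * z$u) = 0}"
  unfolding null_space_on_def using assms by blast

lemma nullity_on_remove_le:
  assumes "v \<in> X" shows "nullity_on M X \<le> nullity_on M (X - {v}) + 1"
proof -
  have "nullity_on M X \<le> Suc (vec.dim {z \<in> null_space_on M X. z$v = 0})"
    unfolding nullity_on_def
    by (rule dim_functional_kernel_le[OF subspace_null_space_on]) simp_all
  also have "\<dots> \<le> Suc (nullity_on M (X - {v}))"
    unfolding null_space_on_remove[OF assms] nullity_on_def by (auto intro: vec.dim_subset)
  finally show ?thesis by simp
qed

lemma nullity_on_remove_ge:
  assumes "v \<in> X" shows "nullity_on M (X - {v}) \<le> nullity_on M X + 1"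
proof -
  have "nullity_on M (X - {v}) \<le>
      Suc (vec.dim {z \<in> null_space_on M (X - {v}). (\<Sum>u\<in>UNIV. M$v$u * z$u) = 0})"
    unfolding nullity_on_def
    by (rule dim_functional_kernel_le[OF subspace_null_space_on])
       (simp_all add: algebra_simps sum.distrib sum_distrib_left)
  also have "\<dots> \<le> Suc (nullity_on M X)"
    unfolding null_space_on_remove[OF assms, symmetric] nullity_on_def by (auto intro: vec.dim_subset)
  finally show ?thesis by simp
qed

text \<open>A null vector with a nonzero entry at \<open>v\<close> makes row \<open>v\<close> a
  combination of the other rows, so the null vectors of \<open>X - {v}\<close> satisfy the equation
  of row \<open>v\<close> automatically.\<close>

lemma nullity_on_remove_supported:
  assumes v: "v \<in> X" and z: "z \<in> null_space_on M X" "z$v \<noteq> 0"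
    and sym: "\<And>u w. M$u$w = M$w$u"
  shows "nullity_on M X = nullity_on M (X - {v}) + 1"
proof -
  have "(\<Sum>u\<in>UNIV. M$v$u * y$u) = 0" if y: "y \<in> null_space_on M (X - {v})" for y
  proof -
    \<comment> \<open>The bilinear form of \<open>z\<close> and \<open>y\<close> is evaluated in two
      ways: it vanishes because \<open>z\<close> is a null vector, and only its term at
      \<open>v\<close> survives because \<open>y\<close> is one on the smaller set.\<close>
    have "(\<Sum>u\<in>UNIV. z$u * (\<Sum>w\<in>UNIV. M$u$w * y$w)) = (\<Sum>w\<in>UNIV. y$w * (\<Sum>u\<in>UNIV. M$w$u * z$u))"
      unfolding sum_distrib_left by (subst sum.swap) (simp add: sym mult_ac)
    also have "\<dots> = 0"
    proof (intro sum.neutral ballI)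
      fix w
      show "y$w * (\<Sum>u\<in>UNIV. M$w$u * z$u) = 0"
        using y z(1) by (cases "w \<in> X") (auto simp: null_space_on_def)
    qed
    also have "(\<Sum>u\<in>UNIV. z$u * (\<Sum>w\<in>UNIV. M$u$w * y$w)) = z$v * (\<Sum>w\<in>UNIV. M$v$w * y$w)"
    proof -
      have "(\<Sum>u\<in>UNIV - {v}. z$u * (\<Sum>w\<in>UNIV. M$u$w * y$w)) = 0"
      proof (intro sum.neutral ballI)
        fix u assume "u \<in> UNIV - {v}"
        then show "z$u * (\<Sum>w\<in>UNIV. M$u$w * y$w) = 0"
          using y z(1) by (cases "u \<in> X") (auto simp: null_space_on_def)
      qed
      then show ?thesis
        using sum.remove[of UNIV v "\<lambda>u. z$u * (\<Sum>w\<in>UNIV. M$u$w * y$w)"] by simp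
    qed
    finally show ?thesis using z(2) by simp
  qed
  then have eq: "{z \<in> null_space_on M X. z$v = 0} = null_space_on M (X - {v})"
    unfolding null_space_on_remove[OF v] by auto
  have "nullity_on M X = Suc (vec.dim {z \<in> null_space_on M X. z$v = 0})"
    unfolding nullity_on_def
    by (rule dim_functional_kernel[where s = z, OF subspace_null_space_on]) (use z in simp_all)
  then show ?thesis unfolding eq nullity_on_def by simp
qed

lemma nullity_on_remove_isolated:
  assumes v: "v \<in> X" and iso: "\<And>u. u \<in> X \<Longrightarrow> M$v$u = 0" "\<And>u. u \<in> X \<Longrightarrow> M$u$v = 0"
  shows "nullity_on M X = nullity_on M (X - {v}) + 1"
proof -
  have "(\<Sum>u\<in>UNIV. M$v$u * y$u) = 0" if y: "y \<in> null_space_on M (X - {v})" for y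
  proof (intro sum.neutral ballI)
    fix u show "M$v$u * y$u = 0"
      using y iso(1) by (cases "u \<in> X") (auto simp: null_space_on_def)
  qed
  then have eq: "{z \<in> null_space_on M X. z$v = 0} = null_space_on M (X - {v})"
    unfolding null_space_on_remove[OF v] by auto
  have "(\<Sum>u\<in>UNIV. M$w$u * axis v 1 $ u) = M$w$v" for w
    by (simp add: axis_def if_distrib cong: if_cong)
  then have "axis v 1 \<in> null_space_on M X"
    using v iso(2) by (auto simp: null_space_on_def axis_def)
  then have "nullity_on M X = Suc (vec.dim {z \<in> null_space_on M X. z$v = 0})"
    unfolding nullity_on_def
    by (intro dim_functional_kernel[OF subspace_null_space_on, where s = "axis v 1"]) simp_all
  then show ?thesis unfolding eq nullity_on_def by simp
qed

text \<open>The equation at \<open>x\<close> forces the entry at \<open>y\<close> to be zero, and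
  the equation at \<open>y\<close> then determines the entry at \<open>x\<close>. Forgetting the
  entry at \<open>x\<close> is thus an isomorphism onto the smaller null space.\<close>

lemma nullity_on_pendant:
  fixes M :: "'a::field ^ 'b ^ ('b::finite)"
  assumes xy: "x \<in> X" "y \<in> X" "x \<noteq> y" and nz: "M$x$y \<noteq> 0" "M$y$x \<noteq> 0"
    and row: "\<And>u. u \<in> X \<Longrightarrow> u \<noteq> y \<Longrightarrow> M$x$u = 0" and col: "\<And>u. u \<in> X \<Longrightarrow> u \<noteq> y \<Longrightarrow> M$u$x = 0"
  shows "nullity_on M X = nullity_on M (X - {x, y})"
proof -
  let ?S = "null_space_on M X" and ?T = "null_space_on M (X - {x, y})"
  define f :: "'a ^ 'b \<Rightarrow> 'a ^ 'b" where "f z = (\<chi> u. if u = x then 0 else z$u)" for z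
  have lin: "Vector_Spaces.linear (*s) (*s) f"
    by (intro Vector_Spaces.linear_iff[THEN iffD2] conjI vec.vector_space_axioms) (auto simp: f_def vec_eq_iff)
  have zy: "z$y = 0" if "z \<in> ?S" for z
  proof -
    have "(\<Sum>u\<in>UNIV. M$x$u * z$u) = M$x$y * z$y"
    proof -
      have "(\<Sum>u\<in>UNIV - {y}. M$x$u * z$u) = 0"
      proof (intro sum.neutral ballI)
        fix u assume "u \<in> UNIV - {y}"
        then show "M$x$u * z$u = 0" using that row by (cases "u \<in> X") (auto simp: null_space_on_def)
      qed
      then show ?thesis by (simp add: sum.remove[of UNIV y])
    qed
    then show ?thesis using that xy nz by (auto simp: null_space_on_def)
  qed
  have split: "(\<Sum>u\<in>UNIV. M$w$u * z$u) = M$w$x * z$x + (\<Sum>u\<in>UNIV. M$w$u * f z $ u)" for w z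
  proof -
    have "(\<Sum>u\<in>UNIV. M$w$u * f z $ u) = (\<Sum>u\<in>UNIV - {x}. M$w$u * z$u)"
      by (rule sum.mono_neutral_cong_right) (auto simp: f_def)
    then show ?thesis by (simp add: sum.remove[of UNIV x "\<lambda>u. M$w$u * z$u"])
  qed
  have inj: "inj_on f ?S"
  proof (rule inj_onI)
    fix z z' assume z: "z \<in> ?S" "z' \<in> ?S" and e: "f z = f z'"
    have "(\<Sum>u\<in>UNIV. M$y$u * z$u) = 0" "(\<Sum>u\<in>UNIV. M$y$u * z'$u) = 0"
      using z xy by (simp_all add: null_space_on_def)
    then have "M$y$x * z$x = M$y$x * z'$x"
      unfolding split[of y z] split[of y z'] e by (simp add: add_eq_0_iff2)
    then have "z$x = z'$x" using nz by simp
    moreover have "z$u = z'$u" if "u \<noteq> x" for u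
      using arg_cong[OF e, of "\<lambda>t. t$u"] that by (simp add: f_def)
    ultimately show "z = z'" by (metis vec_eq_iff)
  qed
  have "f ` ?S = ?T"
  proof (intro equalityI subsetI)
    fix t assume "t \<in> f ` ?S"
    then obtain z where z: "z \<in> ?S" "t = f z" by auto
    have "(\<Sum>u\<in>UNIV. M$w$u * f z $ u) = 0" if "w \<in> X - {x, y}" for w
    proof -
      have "(\<Sum>u\<in>UNIV. M$w$u * z$u) = 0" using z(1) that by (simp add: null_space_on_def)
      then show ?thesis unfolding split[of w z] using col[of w] that by simp
    qed
    then show "t \<in> ?T" using z zy[OF z(1)] by (auto simp: null_space_on_def f_def)
  next
    fix t assume t: "t \<in> ?T"
    \<comment> \<open>The entry at \<open>x\<close> is what the equation of row \<open>y\<close>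
      demands.\<close>
    define z where "z = (\<chi> u. if u = x then - (\<Sum>u\<in>UNIV. M$y$u * t$u) / M$y$x else t$u)"
    have ft: "f z = t" using t by (auto simp: f_def z_def vec_eq_iff null_space_on_def)
    have "(\<Sum>u\<in>UNIV. M$w$u * z$u) = 0" if w: "w \<in> X" for w
    proof (cases "w = y")
      case True
      then show ?thesis unfolding split[of w z] ft using nz by (simp add: z_def)
    next
      case False
      have "(\<Sum>u\<in>UNIV. M$w$u * t$u) = 0"
      proof (cases "w = x")
        case True
        show ?thesis
        proof (intro sum.neutral ballI)
          fix u show "M$w$u * t$u = 0"
            using t row True by (cases "u \<in> X") (auto simp: null_space_on_def)
        qed
      qed (use t w False in \<open>auto simp: null_space_on_def\<close>)
      then show ?thesis unfolding split[of w z] ft using col[of w] w False by simp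
    qed
    moreover have "z$u = 0" if "u \<notin> X" for u
      using t xy that by (auto simp: z_def null_space_on_def)
    ultimately have "z \<in> ?S" by (simp add: null_space_on_def)
    then show "t \<in> f ` ?S" using ft by blast
  qed
  moreover have "vec.dim (f ` ?S) = vec.dim ?S"
    by (rule vec.dim_image_eq[OF lin])
       (use inj in \<open>simp add: vec.span_eq_iff[THEN iffD2] subspace_null_space_on\<close>)
  ultimately show ?thesis by (simp add: nullity_on_def)
qed

lemma nullity_on_disjoint_union:
  assumes disj: "X \<inter> Y = {}"
    and sep: "\<And>u v. u \<in> X \<Longrightarrow> v \<in> Y \<Longrightarrow> M$u$v = 0" "\<And>u v. u \<in> X \<Longrightarrow> v \<in> Y \<Longrightarrow> M$v$u = 0"
  shows "nullity_on M (X \<union> Y) = nullity_on M X + nullity_on M Y"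
proof -
  let ?S = "null_space_on M X" and ?T = "null_space_on M Y"
  have zero: "(\<Sum>v\<in>UNIV. M$u$v * y$v) = 0" if "u \<in> X" "y \<in> ?T" for u y
    using sep(1)[OF that(1)] that(2) by (intro sum.neutral ballI) (auto simp: null_space_on_def)
  have zero': "(\<Sum>v\<in>UNIV. M$u$v * x$v) = 0" if "u \<in> Y" "x \<in> ?S" for u x
    using sep(2)[OF _ that(1)] that(2) by (intro sum.neutral ballI) (auto simp: null_space_on_def)
  have "null_space_on M (X \<union> Y) = {x + y |x y. x \<in> ?S \<and> y \<in> ?T}" (is "?N = ?R")
  proof (intro equalityI subsetI)
    fix z assume z: "z \<in> ?N"
    define x where "x = (\<chi> u. if u \<in> X then z$u else 0)"
    define y where "y = (\<chi> u. if u \<in> Y then z$u else 0)"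
    have zxy: "z = x + y"
      using disj z by (auto simp: x_def y_def vec_eq_iff null_space_on_def)
    have sums: "(\<Sum>v\<in>UNIV. M$u$v * z$v) = (\<Sum>v\<in>UNIV. M$u$v * x$v) + (\<Sum>v\<in>UNIV. M$u$v * y$v)" for u
      by (simp add: zxy algebra_simps sum.distrib)
    have "(\<Sum>v\<in>UNIV. M$u$v * x$v) = 0" if "u \<in> X" for u
    proof -
      have "(\<Sum>v\<in>UNIV. M$u$v * y$v) = 0"
        using sep(1)[OF that] by (intro sum.neutral ballI) (auto simp: y_def)
      then show ?thesis using sums[of u] z that by (auto simp: null_space_on_def)
    qed
    then have x: "x \<in> ?S" by (auto simp: null_space_on_def x_def)
    have "(\<Sum>v\<in>UNIV. M$u$v * y$v) = 0" if "u \<in> Y" for u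
    proof -
      have "(\<Sum>v\<in>UNIV. M$u$v * x$v) = 0"
        using sep(2)[OF _ that] by (intro sum.neutral ballI) (auto simp: x_def)
      then show ?thesis using sums[of u] z that by (auto simp: null_space_on_def)
    qed
    then have y: "y \<in> ?T" by (auto simp: null_space_on_def y_def)
    show "z \<in> ?R" using x y zxy by blast
  next
    fix z assume "z \<in> ?R"
    then obtain x y where xy: "x \<in> ?S" "y \<in> ?T" "z = x + y" by blast
    have "(\<Sum>v\<in>UNIV. M$u$v * z$v) = (\<Sum>v\<in>UNIV. M$u$v * x$v) + (\<Sum>v\<in>UNIV. M$u$v * y$v)" for u
      by (simp add: xy algebra_simps sum.distrib)
    moreover have "(\<Sum>v\<in>UNIV. M$u$v * x$v) = 0" if "u \<in> X \<union> Y" for u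
      using that zero'[OF _ xy(1)] xy(1) by (auto simp: null_space_on_def)
    moreover have "(\<Sum>v\<in>UNIV. M$u$v * y$v) = 0" if "u \<in> X \<union> Y" for u
      using that zero[OF _ xy(2)] xy(2) by (auto simp: null_space_on_def)
    moreover have "z$u = 0" if "u \<notin> X \<union> Y" for u
      using that xy by (auto simp: null_space_on_def)
    ultimately show "z \<in> ?N" by (simp add: null_space_on_def)
  qed
  moreover have "?S \<inter> ?T \<subseteq> {0}"
  proof
    fix x assume "x \<in> ?S \<inter> ?T"
    then have "x$i = 0" for i using disj by (cases "i \<in> X") (auto simp: null_space_on_def)
    then show "x \<in> {0}" by (simp add: vec_eq_iff)
  qed
  then have "vec.dim (?S \<inter> ?T) = 0" by simp
  ultimately show ?thesis
    using vec.dim_sums_Int[OF subspace_null_space_on[of M X] subspace_null_space_on[of M Y]]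
    unfolding nullity_on_def by (metis add_0_right)
qed

lemma nullity_on_empty [simp]: "nullity_on M {} = 0"
proof -
  have "null_space_on M {} \<subseteq> {0}" by (simp add: null_space_on_def vec_eq_iff subset_iff)
  then show ?thesis unfolding nullity_on_def by simp
qed

lemma nullity_on_eq_0_iff: "nullity_on M X = 0 \<longleftrightarrow> (\<forall>z\<in>null_space_on M X. z = 0)"
  unfolding nullity_on_def vec.dim_eq_0 by fast

lemma nullity_on_nonzero: "nullity_on M X \<noteq> 0 \<Longrightarrow> \<exists>z\<in>null_space_on M X. z \<noteq> 0"
  unfolding nullity_on_eq_0_iff by simp

section \<open>Components, cyclomatic number and cycles\<close>

text \<open>No vertex set is mentioned, so the relation is unaffected when isolated vertices are
  added or dropped.\<close>

definition edge_conn :: "'v set set \<Rightarrow> ('v \<times> 'v) set" where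
  "edge_conn F = {(x, y). {x, y} \<in> F}\<^sup>*"

lemma edge_conn_refl [simp]: "(x, x) \<in> edge_conn F"
  by (simp add: edge_conn_def)

lemma edge_conn_sym: "(x, y) \<in> edge_conn F \<Longrightarrow> (y, x) \<in> edge_conn F"
proof -
  have "sym {(x, y). {x, y} \<in> F}" by (auto simp: sym_def insert_commute)
  then show "(x, y) \<in> edge_conn F \<Longrightarrow> (y, x) \<in> edge_conn F"
    unfolding edge_conn_def by (meson sym_rtrancl symD)
qed

lemma edge_conn_trans:
  "(x, y) \<in> edge_conn F \<Longrightarrow> (y, z) \<in> edge_conn F \<Longrightarrow> (x, z) \<in> edge_conn F"
  unfolding edge_conn_def by (rule rtrancl_trans)

lemma edge_conn_edge: "{x, y} \<in> F \<Longrightarrow> (x, y) \<in> edge_conn F"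
  unfolding edge_conn_def by (rule r_into_rtrancl) simp

lemma edge_conn_mono: "F \<subseteq> F' \<Longrightarrow> edge_conn F \<subseteq> edge_conn F'"
  unfolding edge_conn_def by (intro rtrancl_mono) auto

text \<open>A walk needs the new edge at most once, in one of its two directions.\<close>

lemma edge_conn_insert:
  assumes "(p, q) \<in> edge_conn (insert {a, b} F)"
  shows "(p, q) \<in> edge_conn F \<or> (p, a) \<in> edge_conn F \<and> (b, q) \<in> edge_conn F
    \<or> (p, b) \<in> edge_conn F \<and> (a, q) \<in> edge_conn F"
  using assms unfolding edge_conn_def[of "insert {a, b} F"]
proof (induction rule: rtrancl_induct)
  case base
  then show ?case by simp
next
  case (step y z)
  then have "{y, z} \<in> F \<or> (y = a \<and> z = b) \<or> (y = b \<and> z = a)"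
    by (auto simp: doubleton_eq_iff)
  then consider "(y, z) \<in> edge_conn F" | "y = a" "z = b" | "y = b" "z = a"
    using edge_conn_edge by metis
  then show ?case
    using step.IH by cases (metis edge_conn_trans edge_conn_refl edge_conn_sym)+
qed

lemma same_component_eq: "same_component V F = {(u, v). u \<in> V \<and> v \<in> V \<and> (u, v) \<in> edge_conn F}"
  by (simp add: same_component_def edge_conn_def)

lemma equiv_same_component: "equiv V (same_component V F)"
  unfolding same_component_eq
  by (rule equivI) (auto simp: refl_on_def sym_def trans_def intro: edge_conn_sym edge_conn_trans)

lemma num_components_insert_connected:
  assumes "(a, b) \<in> edge_conn F"
  shows "num_components V (insert {a, b} F) = num_components V F"
proof -
  have "edge_conn (insert {a, b} F) = edge_conn F"
  proof (intro equalityI subrelI)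
    fix p q assume "(p, q) \<in> edge_conn (insert {a, b} F)"
    then show "(p, q) \<in> edge_conn F"
      using edge_conn_insert[of p q a b F] assms edge_conn_sym[OF assms] edge_conn_trans by metis
  next
    fix p q assume "(p, q) \<in> edge_conn F"
    then show "(p, q) \<in> edge_conn (insert {a, b} F)"
      using edge_conn_mono[of F "insert {a, b} F"] by blast
  qed
  then show ?thesis by (simp add: num_components_def same_component_eq)
qed

text \<open>Only the classes of \<open>a\<close> and \<open>b\<close> merge. Once the class of
  \<open>a\<close> is set aside, sending an old class to the new class containing it is a
  bijection.\<close>

lemma num_components_insert_disconnected:
  assumes V: "finite V" "a \<in> V" "b \<in> V" and n: "(a, b) \<notin> edge_conn F"
  shows "num_components V F = Suc (num_components V (insert {a, b} F))"
proof -
  let ?R = "same_component V F" and ?R' = "same_component V (insert {a, b} F)"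
  have R: "equiv V ?R" and R': "equiv V ?R'" by (rule equiv_same_component)+
  have sub: "?R \<subseteq> ?R'"
    using edge_conn_mono[of F "insert {a, b} F"] by (auto simp: same_component_eq)
  have img: "?R' `` (?R `` {p}) = ?R' `` {p}" if "p \<in> V" for p
  proof (intro equalityI subsetI)
    fix x assume "x \<in> ?R' `` (?R `` {p})"
    then show "x \<in> ?R' `` {p}"
      using sub R' by (auto simp: equiv_def dest: transD)
  next
    fix x assume "x \<in> ?R' `` {p}"
    then show "x \<in> ?R' `` (?R `` {p})" using that by (auto simp: same_component_eq)
  qed
  have aV: "?R `` {a} \<in> V // ?R" using V by (simp add: quotientI)
  have "bij_betw (\<lambda>c. ?R' `` c) (V // ?R - {?R `` {a}}) (V // ?R')"
  proof (intro bij_betwI')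
    fix c c' assume c: "c \<in> V // ?R - {?R `` {a}}" "c' \<in> V // ?R - {?R `` {a}}"
    then obtain p q where pq: "p \<in> V" "q \<in> V" "c = ?R `` {p}" "c' = ?R `` {q}"
      by (auto elim!: quotientE)
    have na: "(p, a) \<notin> ?R" "(q, a) \<notin> ?R"
      using c pq equiv_class_eq[OF R] by auto
    show "(?R' `` c = ?R' `` c') = (c = c')"
    proof
      assume "?R' `` c = ?R' `` c'"
      then have "(p, q) \<in> ?R'" using img pq R' eq_equiv_class by metis
      then have "(p, q) \<in> edge_conn (insert {a, b} F)" by (simp add: same_component_eq)
      then have "(p, q) \<in> edge_conn F"
        using edge_conn_insert[of p q a b F] na pq V edge_conn_sym[of a q F]
        by (auto simp: same_component_eq)
      then have "(p, q) \<in> ?R" using pq by (simp add: same_component_eq)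
      then show "c = c'" using pq equiv_class_eq[OF R] by simp
    qed simp
  next
    fix c assume "c \<in> V // ?R - {?R `` {a}}"
    then obtain p where "p \<in> V" "c = ?R `` {p}" by (auto elim!: quotientE)
    then show "?R' `` c \<in> V // ?R'" using img quotientI by metis
  next
    fix c' assume "c' \<in> V // ?R'"
    then obtain p where p: "p \<in> V" "c' = ?R' `` {p}" by (auto elim!: quotientE)
    show "\<exists>c\<in>V // ?R - {?R `` {a}}. c' = ?R' `` c"
    proof (cases "(p, a) \<in> ?R")
      case False
      then have "?R `` {p} \<noteq> ?R `` {a}" using eq_equiv_class[OF _ R] V by metis
      then show ?thesis using p img by (intro bexI[of _ "?R `` {p}"]) (auto intro: quotientI)
    next
      case True
      \<comment> \<open>The class of \<open>a\<close> has been set aside, so the merged class is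
        reached from the class of \<open>b\<close>.\<close>
      have "(a, b) \<in> ?R'" using V by (auto simp: same_component_eq intro: edge_conn_edge)
      then have "(p, b) \<in> ?R'" using True sub R' by (meson equivE subsetD transD)
      then have "c' = ?R' `` (?R `` {b})" using p img V equiv_class_eq[OF R'] by metis
      moreover have "(b, a) \<notin> ?R" using n edge_conn_sym[of b a F] by (auto simp: same_component_eq)
      then have "?R `` {b} \<noteq> ?R `` {a}" using eq_equiv_class[OF _ R] V by metis
      ultimately show ?thesis using V by (intro bexI[of _ "?R `` {b}"]) (auto intro: quotientI)
    qed
  qed
  then have "card (V // ?R - {?R `` {a}}) = card (V // ?R')" by (rule bij_betw_same_card)
  moreover have "finite (V // ?R)" using V R by (auto intro: finite_quotient simp: same_component_eq)
  ultimately show ?thesis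
    unfolding num_components_def using aV by (metis card_Suc_Diff1)
qed

lemma num_components_add_vertex:
  assumes "finite V" "v \<notin> V" "\<Union>F \<subseteq> V"
  shows "num_components (insert v V) F = Suc (num_components V F)"
proof -
  let ?R = "same_component V F" and ?R' = "same_component (insert v V) F"
  have v: "(v, x) \<in> edge_conn F \<Longrightarrow> x = v" for x
    unfolding edge_conn_def
    by (induction rule: rtrancl_induct) (use assms in auto)
  have "?R' = insert (v, v) ?R"
    using v edge_conn_sym by (fastforce simp: same_component_eq)
  then have "?R' `` {x} = ?R `` {x}" if "x \<in> V" for x using that assms(2) by auto
  moreover have "?R' `` {v} = {v}" using v assms(2) by (auto simp: same_component_eq)
  ultimately have "insert v V // ?R' = insert {v} (V // ?R)"
    by (auto simp: quotient_def)
  moreover have "{v} \<notin> V // ?R" using assms(2) by (auto simp: quotient_def same_component_eq)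
  moreover have "finite (V // ?R)" using assms(1) by (auto intro: finite_quotient simp: same_component_eq)
  ultimately show ?thesis by (simp add: num_components_def)
qed

section \<open>The cyclomatic number when edges and vertices are added\<close>

lemma cyclomatic_number_insert_connected:
  assumes "finite F" "{a, b} \<notin> F" "(a, b) \<in> edge_conn F"
  shows "cyclomatic_number V (insert {a, b} F) = cyclomatic_number V F + 1"
  using assms by (simp add: cyclomatic_number_def num_components_insert_connected)

lemma cyclomatic_number_insert_disconnected:
  assumes "finite V" "finite F" "a \<in> V" "b \<in> V" "(a, b) \<notin> edge_conn F"
  shows "cyclomatic_number V (insert {a, b} F) = cyclomatic_number V F"
proof -
  have "{a, b} \<notin> F" using assms(5) edge_conn_edge by metis
  then show ?thesis
    using assms num_components_insert_disconnected[of V a b F] by (simp add: cyclomatic_number_def)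
qed

lemma cyclomatic_number_insert_ge:
  assumes "finite V" "finite F" "a \<in> V" "b \<in> V"
  shows "cyclomatic_number V F \<le> cyclomatic_number V (insert {a, b} F)"
  using assms cyclomatic_number_insert_connected[of F a b V]
    cyclomatic_number_insert_disconnected[of V F a b]
  by (cases "{a, b} \<in> F"; cases "(a, b) \<in> edge_conn F") (auto simp: insert_absorb)

lemma cyclomatic_number_mono:
  assumes "finite V" "finite F'" "F \<subseteq> F'" "\<And>e. e \<in> F' \<Longrightarrow> e \<subseteq> V \<and> card e = 2"
  shows "cyclomatic_number V F \<le> cyclomatic_number V F'"
proof -
  have "finite F" using assms(2,3) by (rule rev_finite_subset)
  have "finite D \<Longrightarrow> D \<subseteq> F' \<Longrightarrow> cyclomatic_number V F \<le> cyclomatic_number V (F \<union> D)" for D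
  proof (induction D rule: finite_induct)
    case (insert e D)
    then have "card e = 2" using assms(4)[of e] by simp
    then obtain a b where e: "e = {a, b}" by (meson card_2_iff)
    have "cyclomatic_number V (F \<union> D) \<le> cyclomatic_number V (insert {a, b} (F \<union> D))"
      using insert assms e \<open>finite F\<close> by (intro cyclomatic_number_insert_ge) auto
    then show ?case using insert e by simp
  qed simp
  from this[of F'] show ?thesis using assms by (simp add: Un_absorb1)
qed

lemma cyclomatic_number_add_vertex:
  assumes "finite V" "v \<notin> V" "\<Union>F \<subseteq> V"
  shows "cyclomatic_number (insert v V) F = cyclomatic_number V F"
  using assms num_components_add_vertex[OF assms] by (simp add: cyclomatic_number_def)

lemma cyclomatic_number_no_edges:
  "finite V \<Longrightarrow> cyclomatic_number V {} = 0"
proof (induction V rule: finite_induct)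
  case empty
  then show ?case by (simp add: cyclomatic_number_def num_components_def quotient_def)
qed (simp add: cyclomatic_number_add_vertex)

lemma cyclomatic_number_nonneg:
  assumes "finite V" "finite F" "\<And>e. e \<in> F \<Longrightarrow> e \<subseteq> V \<and> card e = 2"
  shows "0 \<le> cyclomatic_number V F"
  using cyclomatic_number_mono[of V F "{}"] cyclomatic_number_no_edges[of V] assms by auto

lemma cyclomatic_number_add_vertices:
  assumes "finite V'" "V \<subseteq> V'" "\<Union>F \<subseteq> V"
  shows "cyclomatic_number V' F = cyclomatic_number V F"
proof -
  have "finite V" using assms(1,2) by (rule rev_finite_subset)
  have "finite D \<Longrightarrow> D \<inter> V = {} \<Longrightarrow> cyclomatic_number (V \<union> D) F = cyclomatic_number V F" for D
  proof (induction D rule: finite_induct)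
    case (insert v D)
    have "cyclomatic_number (insert v (V \<union> D)) F = cyclomatic_number (V \<union> D) F"
      using insert assms \<open>finite V\<close> by (intro cyclomatic_number_add_vertex) auto
    then show ?case using insert by simp
  qed simp
  from this[of "V' - V"] show ?thesis using assms by (simp add: Un_absorb1 inf_commute)
qed

section \<open>Paths, cycles and forests\<close>

lemma edge_conn_distinct_path:
  assumes "(a, b) \<in> edge_conn F"
  shows "\<exists>xs. distinct xs \<and> xs \<noteq> [] \<and> hd xs = a \<and> last xs = b
    \<and> (\<forall>i. Suc i < length xs \<longrightarrow> {xs ! i, xs ! Suc i} \<in> F)"
  using assms unfolding edge_conn_def
proof (induction rule: rtrancl_induct)
  case base
  show ?case by (intro exI[of _ "[a]"]) simp
next
  case (step y z)
  then obtain xs where xs: "distinct xs" "xs \<noteq> []" "hd xs = a" "last xs = y"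
    "\<And>i. Suc i < length xs \<Longrightarrow> {xs ! i, xs ! Suc i} \<in> F" by blast
  show ?case
  proof (cases "z \<in> set xs")
    \<comment> \<open>The walk has returned to a vertex of the path; the loop is cut off by keeping
      the path only up to that vertex.\<close>
    case True
    then obtain k where k: "k < length xs" "xs ! k = z" by (auto simp: in_set_conv_nth)
    show ?thesis
    proof (intro exI[of _ "take (Suc k) xs"] conjI allI impI)
      show "last (take (Suc k) xs) = z" using k by (simp add: take_Suc_conv_app_nth)
      show "hd (take (Suc k) xs) = a" using xs by (simp add: hd_take)
      show "take (Suc k) xs \<noteq> []" using xs by simp
      fix i assume "Suc i < length (take (Suc k) xs)"
      then show "{take (Suc k) xs ! i, take (Suc k) xs ! Suc i} \<in> F" using xs(5)[of i] by simp
    qed (use xs in simp)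
  next
    case False
    show ?thesis
    proof (intro exI[of _ "xs @ [z]"] conjI allI impI)
      fix i assume i: "Suc i < length (xs @ [z])"
      show "{(xs @ [z]) ! i, (xs @ [z]) ! Suc i} \<in> F"
      proof (cases "Suc i < length xs")
        case True
        then show ?thesis using xs(5)[of i] by (simp add: nth_append)
      next
        case False
        then have l: "length xs = Suc i" using i by simp
        then have "xs ! i = y" using xs(2,4) by (simp add: last_conv_nth)
        then show ?thesis using step.hyps l by (simp add: nth_append)
      qed
    qed (use xs False in auto)
  qed
qed

text \<open>A path from \<open>a\<close> to \<open>b\<close> is closed by the new edge. It has at
  least three vertices because \<open>a\<close> and \<open>b\<close> differ and are not yet
  adjacent.\<close>

lemma cycle_through_new_edge:
  assumes "(a, b) \<in> edge_conn F" "{a, b} \<notin> F" "a \<noteq> b"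
  shows "\<exists>xs. is_cycle (insert {a, b} F) xs \<and> {a, b} \<in> cycle_edges xs"
proof -
  obtain xs where xs: "distinct xs" "xs \<noteq> []" "hd xs = a" "last xs = b"
    "\<And>i. Suc i < length xs \<Longrightarrow> {xs ! i, xs ! Suc i} \<in> F"
    using edge_conn_distinct_path[OF assms(1)] by blast
  have x0: "xs ! 0 = a" and xl: "xs ! (length xs - 1) = b"
    using xs by (simp_all add: hd_conv_nth last_conv_nth)
  have "length xs \<noteq> 1" using x0 xl assms(3) by auto
  moreover have "length xs \<noteq> 2" using x0 xl xs(5)[of 0] assms(2) by auto
  ultimately have len: "length xs \<ge> 3" using xs(2) length_0_conv[of xs] by linarith
  have "e = {a, b} \<or> e \<in> F" if e: "e \<in> cycle_edges xs" for e
  proof -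
    obtain i where i: "i < length xs" "e = {xs ! i, cycle_next xs i}"
      using e by (auto simp: cycle_edges_def)
    show ?thesis
    proof (cases "Suc i < length xs")
      case True
      then show ?thesis using xs(5)[of i] i by (simp add: cycle_next_def)
    next
      case False
      then have "Suc i = length xs" using i by simp
      then have "cycle_next xs i = a" "xs ! i = b"
        using x0 xl \<open>Suc i = length xs\<close>[symmetric] by (simp_all add: cycle_next_def)
      then show ?thesis using i by (auto simp: insert_commute)
    qed
  qed
  moreover have "{a, b} \<in> cycle_edges xs"
  proof -
    have "Suc (length xs - 1) = length xs" using len by simp
    then have "{a, b} = {xs ! (length xs - 1), cycle_next xs (length xs - 1)}"
      unfolding cycle_next_def using x0 xl by auto
    then show ?thesis using len unfolding cycle_edges_def by fastforce
  qed
  ultimately show ?thesis using xs(1) len by (auto simp: is_cycle_def)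
qed

lemma is_cycle_mono: "is_cycle F xs \<Longrightarrow> F \<subseteq> F' \<Longrightarrow> is_cycle F' xs"
  by (auto simp: is_cycle_def)

lemma cycle_through_edge:
  assumes "{a, b} \<in> F" "a \<noteq> b" "(a, b) \<in> edge_conn (F - {{a, b}})"
  shows "\<exists>xs. is_cycle F xs \<and> {a, b} \<in> cycle_edges xs"
  using cycle_through_new_edge[OF assms(3) _ assms(2)] assms(1) by (simp add: insert_absorb)

text \<open>Each edge added to a forest joins two different components, since otherwise it would
  close a cycle.\<close>

lemma cyclomatic_number_acyclic:
  assumes "finite F" "finite V" "\<And>e. e \<in> F \<Longrightarrow> e \<subseteq> V \<and> card e = 2" "\<not> (\<exists>xs. is_cycle F xs)"
  shows "cyclomatic_number V F = 0"
  using assms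
proof (induction F rule: finite_induct)
  case empty
  then show ?case by (simp add: cyclomatic_number_no_edges)
next
  case (insert e F)
  then have "card e = 2" by simp
  then obtain a b where e: "e = {a, b}" "a \<noteq> b" by (meson card_2_iff)
  have "(a, b) \<notin> edge_conn F"
    using cycle_through_new_edge[of a b F] insert.prems insert.hyps e by auto
  then have "cyclomatic_number V (insert e F) = cyclomatic_number V F"
    unfolding e using insert e by (intro cyclomatic_number_insert_disconnected) auto
  moreover have "cyclomatic_number V F = 0"
    using insert is_cycle_mono[of F _ "insert e F"] by blast
  ultimately show ?case by simp
qed

text \<open>A forest on a nonempty vertex set has at least one component and hence fewer edges than
  vertices. This is the counting principle behind both degree arguments below.\<close>

lemma cycle_exists:
  assumes "finite V" "finite F" "V \<noteq> {}" "card V \<le> card F" "\<And>e. e \<in> F \<Longrightarrow> e \<subseteq> V \<and> card e = 2"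
  shows "\<exists>xs. is_cycle F xs"
proof (rule ccontr)
  assume "\<not> ?thesis"
  then have "cyclomatic_number V F = 0" using assms cyclomatic_number_acyclic by blast
  then have "num_components V F = 0" using assms(4) by (simp add: cyclomatic_number_def)
  moreover have "finite (V // same_component V F)"
    using assms(1) by (auto intro: finite_quotient simp: same_component_eq)
  moreover have "V // same_component V F \<noteq> {}" using assms(3) by (auto simp: quotient_def)
  ultimately show False by (simp add: num_components_def)
qed

text \<open>Indices run periodically over all natural numbers, so the closing edge of a cycle needs
  no separate treatment.\<close>

definition cyc_nth :: "'v list \<Rightarrow> nat \<Rightarrow> 'v" where
  "cyc_nth xs j = xs ! (j mod length xs)"

lemma cyc_nth_in_set [simp]: "xs \<noteq> [] \<Longrightarrow> cyc_nth xs j \<in> set xs"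
  by (simp add: cyc_nth_def)

lemma cyc_nth_add_length [simp]: "cyc_nth xs (j + length xs) = cyc_nth xs j"
  by (simp add: cyc_nth_def)

lemma set_eq_cyc_nth: "v \<in> set xs \<Longrightarrow> \<exists>j<length xs. v = cyc_nth xs j"
  by (auto simp: in_set_conv_nth cyc_nth_def)

lemma cyc_nth_eq_iff:
  assumes "distinct xs" "xs \<noteq> []"
  shows "cyc_nth xs i = cyc_nth xs j \<longleftrightarrow> i mod length xs = j mod length xs"
  using assms by (simp add: cyc_nth_def nth_eq_iff_index_eq)

lemma cycle_edges_eq:
  assumes "xs \<noteq> []"
  shows "cycle_edges xs = {{cyc_nth xs j, cyc_nth xs (Suc j)} | j. True}"
proof (intro equalityI subsetI)
  fix e assume "e \<in> {{cyc_nth xs j, cyc_nth xs (Suc j)} | j. True}"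
  then obtain j where "e = {cyc_nth xs j, cyc_nth xs (Suc j)}" by blast
  then have "e = {xs ! (j mod length xs), cycle_next xs (j mod length xs)}"
    by (simp add: cyc_nth_def cycle_next_def mod_Suc_eq)
  moreover have "j mod length xs < length xs" using assms by simp
  ultimately show "e \<in> cycle_edges xs" unfolding cycle_edges_def by blast
next
  fix e assume "e \<in> cycle_edges xs"
  then obtain i where "i < length xs" "e = {xs ! i, cycle_next xs i}" by (auto simp: cycle_edges_def)
  then have "e = {cyc_nth xs i, cyc_nth xs (Suc i)}" by (simp add: cyc_nth_def cycle_next_def)
  then show "e \<in> {{cyc_nth xs j, cyc_nth xs (Suc j)} | j. True}" by blast
qed

lemma cycle_edges_subset: "e \<in> cycle_edges xs \<Longrightarrow> e \<subseteq> set xs"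
  by (auto simp: cycle_edges_def cycle_next_def intro!: nth_mem mod_less_divisor)

lemma induced_edges_mono: "X \<subseteq> Y \<Longrightarrow> induced_edges E X \<subseteq> induced_edges E Y"
  by (auto simp: induced_edges_def)

lemma induced_edge_iff [simp]: "{u, v} \<in> induced_edges E X \<longleftrightarrow> {u, v} \<in> E \<and> u \<in> X \<and> v \<in> X"
  by (auto simp: induced_edges_def)

lemma is_cycle_induced_iff: "is_cycle (induced_edges E X) xs \<longleftrightarrow> is_cycle E xs \<and> set xs \<subseteq> X"
proof
  assume "is_cycle (induced_edges E X) xs"
  then have len: "length xs \<ge> 3" and sub: "cycle_edges xs \<subseteq> induced_edges E X" and "distinct xs"
    by (auto simp: is_cycle_def)
  have "v \<in> X" if v: "v \<in> set xs" for v
  proof -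
    obtain i where "i < length xs" "xs ! i = v" using v by (auto simp: in_set_conv_nth)
    then have "{v, cycle_next xs i} \<in> cycle_edges xs" by (auto simp: cycle_edges_def)
    then show ?thesis using sub by auto
  qed
  then show "is_cycle E xs \<and> set xs \<subseteq> X"
    using len sub \<open>distinct xs\<close> by (auto simp: is_cycle_def induced_edges_def)
next
  assume "is_cycle E xs \<and> set xs \<subseteq> X"
  then show "is_cycle (induced_edges E X) xs"
    using cycle_edges_subset by (fastforce simp: is_cycle_def induced_edges_def)
qed

lemma edge_conn_closed:
  assumes "(a, b) \<in> edge_conn (induced_edges E X)" "a \<in> X"
  shows "b \<in> X"
  using assms(1) unfolding edge_conn_def
  by (induction rule: rtrancl_induct) (use assms(2) in auto)

lemma is_cycle_neighbours:
  assumes xs: "is_cycle E xs" and v: "v \<in> set xs"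
  obtains p q where "p \<noteq> q" "p \<in> set xs - {v}" "q \<in> set xs - {v}"
    "\<And>u. {v, u} \<in> cycle_edges xs \<longleftrightarrow> u = p \<or> u = q"
    "\<And>s. s \<in> set xs - {v} \<Longrightarrow> (p, s) \<in> edge_conn (induced_edges E (set xs - {v}))"
proof -
  let ?l = "length xs" and ?x = "cyc_nth xs"
  have l: "?l \<ge> 3" and dist: "distinct xs" and ne: "xs \<noteq> []" and sub: "cycle_edges xs \<subseteq> E"
    using xs by (auto simp: is_cycle_def)
  obtain k where k: "k < ?l" "v = ?x k" using set_eq_cyc_nth[OF v] by blast
  have mk: "k mod ?l = k" using k by simp
  have xeq: "?x i = ?x j \<longleftrightarrow> i mod ?l = j mod ?l" for i j
    by (rule cyc_nth_eq_iff[OF dist ne])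
  have edge: "{?x j, ?x (Suc j)} \<in> E" for j
    using sub cycle_edges_eq[OF ne] by blast
  have shift: "(k + i) mod ?l \<noteq> (k + j) mod ?l" if "i < j" "j < ?l" for i j
  proof
    assume "(k + i) mod ?l = (k + j) mod ?l"
    then have "?l dvd (k + j) - (k + i)" by (metis mod_eq_dvd_iff_nat add_le_cancel_left less_imp_le that(1))
    then show False using that by (auto dest: dvd_imp_le)
  qed
  have nev: "?x (k + j) \<noteq> v" if "0 < j" "j < ?l" for j
    using shift[of 0 j] that k xeq by simp
  \<comment> \<open>These are the successor and the predecessor of \<open>v\<close>. One step back
    is written as \<open>?l - 1\<close> steps forward, which avoids truncated subtraction.\<close>
  define p q where "p = ?x (k + 1)" and "q = ?x (k + (?l - 1))"
  have pq: "p \<noteq> q" unfolding p_def q_def xeq using l by (intro shift) auto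
  have p: "p \<in> set xs - {v}" unfolding p_def using nev[of 1] l ne by simp
  have q: "q \<in> set xs - {v}" unfolding q_def using nev[of "?l - 1"] l ne by simp
  have qv: "?x (Suc (k + (?l - 1))) = v"
  proof -
    have "Suc (k + (?l - 1)) = k + ?l" using l by simp
    then show ?thesis using k by simp
  qed
  have nb: "{v, u} \<in> cycle_edges xs \<longleftrightarrow> u = p \<or> u = q" for u
  proof
    assume "{v, u} \<in> cycle_edges xs"
    then obtain j where j: "{v, u} = {?x j, ?x (Suc j)}" unfolding cycle_edges_eq[OF ne] by blast
    then consider "v = ?x j" "u = ?x (Suc j)" | "v = ?x (Suc j)" "u = ?x j"
      by (auto simp: doubleton_eq_iff)
    then show "u = p \<or> u = q"
    proof cases
      case 1
      then have "j mod ?l = k mod ?l" using k xeq by auto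
      then have "Suc j mod ?l = (k + 1) mod ?l" by (metis Suc_eq_plus1 mod_Suc_eq)
      then show ?thesis using 1 xeq p_def by auto
    next
      case 2
      then have "Suc j mod ?l = k mod ?l" using k xeq by auto
      then have "(Suc j + (?l - 1)) mod ?l = (k + (?l - 1)) mod ?l" by (metis mod_add_left_eq)
      moreover have "Suc j + (?l - 1) = j + ?l" using l by simp
      ultimately have "j mod ?l = (k + (?l - 1)) mod ?l" by (metis mod_add_self2)
      then show ?thesis using 2 xeq q_def by auto
    qed
  next
    have "{v, p} \<in> cycle_edges xs"
      unfolding cycle_edges_eq[OF ne] p_def k by (auto intro!: exI[of _ k])
    moreover have "{v, q} \<in> cycle_edges xs"
      unfolding cycle_edges_eq[OF ne] using qv q_def
      by (auto intro!: exI[of _ "k + (?l - 1)"] simp: insert_commute)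
    ultimately show "u = p \<or> u = q \<Longrightarrow> {v, u} \<in> cycle_edges xs" by auto
  qed
  have conn: "j < ?l - 1 \<Longrightarrow> (p, ?x (k + 1 + j)) \<in> edge_conn (induced_edges E (set xs - {v}))" for j
  proof (induction j)
    case 0
    then show ?case by (simp add: p_def)
  next
    case (Suc j)
    have "{?x (k + 1 + j), ?x (Suc (k + 1 + j))} \<in> induced_edges E (set xs - {v})"
      using edge[of "k + 1 + j"] nev[of "1 + j"] nev[of "1 + Suc j"] Suc.prems ne by simp
    then have "(?x (k + 1 + j), ?x (Suc (k + 1 + j))) \<in> edge_conn (induced_edges E (set xs - {v}))"
      by (rule edge_conn_edge)
    moreover have "(p, ?x (k + 1 + j)) \<in> edge_conn (induced_edges E (set xs - {v}))"
      using Suc by simp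
    ultimately show ?case unfolding add_Suc_right by (meson edge_conn_trans)
  qed
  have "(p, s) \<in> edge_conn (induced_edges E (set xs - {v}))" if s: "s \<in> set xs - {v}" for s
  proof -
    obtain i where i: "i < ?l" "s = ?x i" using set_eq_cyc_nth s by (metis DiffD1)
    have "i \<noteq> k" using i k s by auto
    \<comment> \<open>The number of forward steps from the successor of \<open>v\<close> to
      \<open>s\<close>.\<close>
    define j where "j = (if k < i then i - k - 1 else i + ?l - k - 1)"
    have "j < ?l - 1" using i k \<open>i \<noteq> k\<close> by (auto simp: j_def)
    moreover have "k + 1 + j = i \<or> k + 1 + j = i + ?l" using i k \<open>i \<noteq> k\<close> by (auto simp: j_def)
    then have "?x (k + 1 + j) = s" using i by (metis cyc_nth_add_length)
    ultimately
    show ?thesis using conn[of j] by metis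
  qed
  then show ?thesis using that[of p q] pq p q nb by blast
qed

text \<open>The first edge at \<open>v\<close> cannot lower the cyclomatic number; after it
  \<open>v\<close> reaches \<open>b\<close> through \<open>a\<close>, so the second edge closes a
  cycle.\<close>

lemma cyclomatic_number_star_two:
  assumes "finite V" "finite F" "v \<in> V" "a \<in> V" "b \<in> V" "a \<noteq> b" "(a, b) \<in> edge_conn F" "{v, b} \<notin> F"
  shows "cyclomatic_number V F + 1 \<le> cyclomatic_number V (insert {v, b} (insert {v, a} F))"
proof -
  let ?F = "insert {v, a} F"
  have "(v, a) \<in> edge_conn ?F" "(a, b) \<in> edge_conn ?F"
    using assms(7) edge_conn_mono[of F ?F] by (auto intro: edge_conn_edge)
  then have "(v, b) \<in> edge_conn ?F" by (rule edge_conn_trans)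
  moreover have "{v, b} \<notin> ?F" using assms(6,8) by (auto simp: doubleton_eq_iff)
  ultimately have "cyclomatic_number V (insert {v, b} ?F) = cyclomatic_number V ?F + 1"
    using assms(2) by (intro cyclomatic_number_insert_connected) auto
  then show ?thesis using cyclomatic_number_insert_ge[of V F v a] assms by simp
qed

section \<open>Induced subgraphs of a finite graph\<close>

locale finite_graph =
  fixes E :: "('v::finite) set set"
  assumes card_edge: "e \<in> E \<Longrightarrow> card e = 2"
begin

abbreviation ind :: "'v set \<Rightarrow> 'v set set" where
  "ind X \<equiv> induced_edges E X"

definition cyclomatic :: "'v set \<Rightarrow> int" where
  "cyclomatic X = cyclomatic_number X (ind X)"

definition cycle_vertices :: "'v set \<Rightarrow> 'v set" where
  "cycle_vertices X = \<Union>{set xs | xs. is_cycle E xs \<and> set xs \<subseteq> X}"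

text \<open>A pendant vertex named together with its neighbour, since deletions always remove
  both.\<close>

definition pendant_pair :: "'v set \<Rightarrow> 'v \<Rightarrow> 'v \<Rightarrow> bool" where
  "pendant_pair X x y \<longleftrightarrow> x \<in> X \<and> y \<in> X \<and> {x, y} \<in> E \<and> (\<forall>u\<in>X. {x, u} \<in> E \<longrightarrow> u = y)"

lemma no_loop [simp]: "{u} \<notin> E"
  using card_edge[of "{u}"] by auto

lemma edge_ne: "{u, v} \<in> E \<Longrightarrow> u \<noteq> v"
  by auto

lemma ind_edge: "e \<in> ind X \<Longrightarrow> e \<subseteq> X \<and> card e = 2"
  by (auto simp: induced_edges_def card_edge)

lemma cyclomatic_nonneg: "0 \<le> cyclomatic X"
  unfolding cyclomatic_def using ind_edge by (intro cyclomatic_number_nonneg) auto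

lemma cyclomatic_mono:
  assumes "X \<subseteq> Y" shows "cyclomatic X \<le> cyclomatic Y"
proof -
  have "cyclomatic X = cyclomatic_number Y (ind X)"
    unfolding cyclomatic_def
    by (rule cyclomatic_number_add_vertices[symmetric]) (use assms in \<open>auto simp: induced_edges_def\<close>)
  also have "\<dots> \<le> cyclomatic Y"
    unfolding cyclomatic_def
    by (rule cyclomatic_number_mono) (use ind_edge induced_edges_mono[OF assms] in auto)
  finally show ?thesis .
qed

lemma cyclomatic_le_of_subset:
  assumes "F \<subseteq> ind X"
  shows "cyclomatic_number X F \<le> cyclomatic X"
  unfolding cyclomatic_def by (rule cyclomatic_number_mono) (use ind_edge assms in auto)

text \<open>Keeping \<open>v\<close> as an isolated vertex gives the graphs before and after the
  deletion the same vertex set, so the edges at \<open>v\<close> can be put back one at a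
  time.\<close>

lemma cyclomatic_remove:
  "cyclomatic (X - {v}) = cyclomatic_number X (ind (X - {v}))"
  unfolding cyclomatic_def
  by (rule cyclomatic_number_add_vertices[symmetric]) (auto simp: induced_edges_def)

lemma cyclomatic_remove_on_cycle:
  assumes "v \<in> X" and ab: "a \<noteq> b" "a \<in> X" "b \<in> X" "{v, a} \<in> E" "{v, b} \<in> E"
    "(a, b) \<in> edge_conn (ind (X - {v}))"
  shows "cyclomatic (X - {v}) + 1 \<le> cyclomatic X"
proof -
  let ?F = "ind (X - {v})"
  have "cyclomatic (X - {v}) + 1 \<le> cyclomatic_number X (insert {v, b} (insert {v, a} ?F))"
    unfolding cyclomatic_remove using assms by (intro cyclomatic_number_star_two) auto
  also have "\<dots> \<le> cyclomatic X"
    using assms induced_edges_mono[of "X - {v}" X E] by (intro cyclomatic_le_of_subset) auto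
  finally show ?thesis .
qed

text \<open>Two different pairs of neighbours, each connected outside \<open>v\<close>, show that at
  least two independent cycles pass through \<open>v\<close>. In a tight graph this is the
  contradiction that makes cycles sharing a vertex coincide.\<close>

lemma cyclomatic_remove_two_cycles:
  assumes v: "v \<in> X" and ab: "a \<noteq> b" "a \<in> X" "b \<in> X" "{v, a} \<in> E" "{v, b} \<in> E"
    "(a, b) \<in> edge_conn (ind (X - {v}))"
    and cd: "c \<noteq> d" "c \<in> X" "d \<in> X" "{v, c} \<in> E" "{v, d} \<in> E"
    "(c, d) \<in> edge_conn (ind (X - {v}))"
    and ne: "{a, b} \<noteq> {c, d}"
  shows "cyclomatic (X - {v}) + 2 \<le> cyclomatic X"
proof -
  let ?F = "ind (X - {v})"
  define F2 where "F2 = insert {v, b} (insert {v, a} ?F)"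
  have F2: "cyclomatic (X - {v}) + 1 \<le> cyclomatic_number X F2"
    unfolding cyclomatic_remove F2_def using v ab by (intro cyclomatic_number_star_two) auto
  have sub: "F2 \<subseteq> ind X"
    using v ab induced_edges_mono[of "X - {v}" X E] by (auto simp: F2_def)
  have conn: "(v, a) \<in> edge_conn F2" "(v, b) \<in> edge_conn F2" "(c, d) \<in> edge_conn F2"
    using cd(6) edge_conn_mono[of ?F F2] by (auto simp: F2_def intro: edge_conn_edge)
  have mem: "{v, u} \<in> F2 \<longleftrightarrow> u = a \<or> u = b" for u by (auto simp: F2_def doubleton_eq_iff)
  \<comment> \<open>In \<open>F2\<close> the vertex \<open>v\<close> is already joined to
    \<open>s\<close> and thus connected to \<open>t\<close>, so one more edge at \<open>v\<close>
    closes a second cycle.\<close>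
  have step: "cyclomatic_number X F2 + 1 \<le> cyclomatic X"
    if "(s = a \<or> s = b)" "t \<noteq> a" "t \<noteq> b" "(s, t) \<in> edge_conn F2" "t \<in> X" "{v, t} \<in> E" for s t
  proof -
    have "(v, t) \<in> edge_conn F2" using that conn edge_conn_trans by metis
    then have "cyclomatic_number X (insert {v, t} F2) = cyclomatic_number X F2 + 1"
      using that mem by (intro cyclomatic_number_insert_connected) auto
    moreover have "cyclomatic_number X (insert {v, t} F2) \<le> cyclomatic X"
      using that sub v by (intro cyclomatic_le_of_subset) auto
    ultimately show ?thesis by simp
  qed
  \<comment> \<open>Different pairs share at most one vertex: either one member of the second pair
    is new and connected to a known neighbour, or both are new and form a star of their own.\<close>
  consider "c = a \<or> c = b" "d \<noteq> a" "d \<noteq> b" | "d = a \<or> d = b" "c \<noteq> a" "c \<noteq> b"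
    | "c \<noteq> a" "c \<noteq> b" "d \<noteq> a" "d \<noteq> b"
    using ne cd(1) by auto
  then have "cyclomatic_number X F2 + 1 \<le> cyclomatic X"
  proof cases
    case 1
    then show ?thesis using step[of c d] conn cd by blast
  next
    case 2
    then show ?thesis using step[of d c] edge_conn_sym[OF conn(3)] cd by blast
  next
    case 3
    have "cyclomatic_number X F2 + 1 \<le> cyclomatic_number X (insert {v, d} (insert {v, c} F2))"
      using 3 cd v conn mem by (intro cyclomatic_number_star_two) auto
    also have "\<dots> \<le> cyclomatic X"
      using cd sub v by (intro cyclomatic_le_of_subset) auto
    finally show ?thesis .
  qed
  then show ?thesis using F2 by simp
qed

lemma cycle_neighbours:
  assumes xs: "is_cycle E xs" "set xs \<subseteq> X" and v: "v \<in> set xs"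
  obtains p q where "p \<noteq> q" "p \<in> set xs - {v}" "q \<in> set xs - {v}" "{v, p} \<in> E" "{v, q} \<in> E"
    "\<And>u. {v, u} \<in> cycle_edges xs \<longleftrightarrow> u = p \<or> u = q"
    "\<And>s. s \<in> set xs - {v} \<Longrightarrow> (p, s) \<in> edge_conn (ind (X - {v}))"
    "(p, q) \<in> edge_conn (ind (X - {v}))"
proof -
  obtain p q where pq: "p \<noteq> q" "p \<in> set xs - {v}" "q \<in> set xs - {v}"
    "\<And>u. {v, u} \<in> cycle_edges xs \<longleftrightarrow> u = p \<or> u = q"
    "\<And>s. s \<in> set xs - {v} \<Longrightarrow> (p, s) \<in> edge_conn (ind (set xs - {v}))"
    by (rule is_cycle_neighbours[OF xs(1) v]) (rule that)
  have m: "edge_conn (ind (set xs - {v})) \<subseteq> edge_conn (ind (X - {v}))"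
    using xs(2) by (intro edge_conn_mono induced_edges_mono) auto
  have "cycle_edges xs \<subseteq> E" using xs(1) by (simp add: is_cycle_def)
  then have "{v, p} \<in> E" "{v, q} \<in> E" using pq(4) by blast+
  then show ?thesis using that[of p q] pq m by blast
qed

lemma cyclomatic_remove_cycle_vertex:
  assumes "v \<in> cycle_vertices X" shows "cyclomatic (X - {v}) + 1 \<le> cyclomatic X"
proof -
  obtain xs where xs: "is_cycle E xs" "set xs \<subseteq> X" "v \<in> set xs"
    using assms by (auto simp: cycle_vertices_def)
  obtain p q where "p \<noteq> q" "p \<in> set xs - {v}" "q \<in> set xs - {v}" "{v, p} \<in> E" "{v, q} \<in> E"
    "(p, q) \<in> edge_conn (ind (X - {v}))"
    by (rule cycle_neighbours[OF xs]) (rule that)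
  then show ?thesis using xs by (intro cyclomatic_remove_on_cycle[of v X p q]) auto
qed

text \<open>Going from \<open>v\<close> to \<open>b\<close> and on to \<open>a\<close> outside
  \<open>v\<close> avoids the edge from \<open>v\<close> to \<open>a\<close>, which then closes the
  cycle.\<close>

lemma cycle_of_connected_neighbours:
  assumes "v \<in> X" "a \<noteq> b" "a \<in> X" "b \<in> X" "{v, a} \<in> E" "{v, b} \<in> E"
    "(a, b) \<in> edge_conn (ind (X - {v}))"
  shows "\<exists>xs. is_cycle E xs \<and> set xs \<subseteq> X \<and> {v, a} \<in> cycle_edges xs"
proof -
  have "ind (X - {v}) \<subseteq> ind X - {{v, a}}" by (auto simp: induced_edges_def)
  then have "(a, b) \<in> edge_conn (ind X - {{v, a}})" using assms(7) edge_conn_mono by blast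
  moreover have "{b, v} \<in> ind X - {{v, a}}"
    using assms by (auto simp: insert_commute doubleton_eq_iff)
  ultimately have "(v, a) \<in> edge_conn (ind X - {{v, a}})"
    by (meson edge_conn_edge edge_conn_trans edge_conn_sym)
  moreover have "v \<noteq> a" using assms edge_ne by blast
  ultimately show ?thesis
    using cycle_through_edge[of v a "ind X"] assms by (auto simp: is_cycle_induced_iff)
qed

lemma vertex_on_cycle:
  assumes "v \<in> e" "e \<in> cycle_edges xs" "is_cycle E xs" "set xs \<subseteq> X"
  shows "v \<in> cycle_vertices X"
  using assms cycle_edges_subset[of e xs] by (auto simp: cycle_vertices_def)

lemma cycle_vertices_subset: "cycle_vertices X \<subseteq> X"
  by (auto simp: cycle_vertices_def)

lemma cycle_vertices_mono: "X \<subseteq> Y \<Longrightarrow> cycle_vertices X \<subseteq> cycle_vertices Y"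
  by (auto simp: cycle_vertices_def)

text \<open>Double counting of the pairs of a vertex of \<open>B\<close> and an edge through
  it.\<close>

lemma sum_degrees:
  assumes "B \<subseteq> X"
  shows "(\<Sum>b\<in>B. card {u\<in>X. {b, u} \<in> E}) = (\<Sum>e\<in>ind X. card (e \<inter> B))"
proof -
  have deg: "card {u\<in>X. {b, u} \<in> E} = card {e\<in>ind X. b \<in> e}" if "b \<in> B" for b
  proof (rule bij_betw_same_card[of "\<lambda>u. {b, u}"], intro bij_betwI')
    fix e assume "e \<in> {e \<in> ind X. b \<in> e}"
    then have e: "e \<subseteq> X" "card e = 2" "b \<in> e" "e \<in> E"
      using ind_edge[of e X] by (auto simp: induced_edges_def)
    then obtain s t where "e = {s, t}" by (meson card_2_iff)
    then obtain u where "e = {b, u}" using e(3) by auto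
    then show "\<exists>u\<in>{u \<in> X. {b, u} \<in> E}. e = {b, u}" using e by auto
  qed (use that assms in \<open>auto simp: doubleton_eq_iff\<close>)
  have "(\<Sum>b\<in>B. card {u\<in>X. {b, u} \<in> E}) = (\<Sum>b\<in>B. \<Sum>e\<in>ind X. of_bool (b \<in> e))"
  proof (intro sum.cong refl)
    fix b assume "b \<in> B"
    have "{e\<in>ind X. b \<in> e} = ind X \<inter> {e. b \<in> e}" by blast
    then show "card {u\<in>X. {b, u} \<in> E} = (\<Sum>e\<in>ind X. of_bool (b \<in> e))"
      using deg[OF \<open>b \<in> B\<close>] by (simp add: sum_of_bool_eq)
  qed
  also have "\<dots> = (\<Sum>e\<in>ind X. \<Sum>b\<in>B. of_bool (b \<in> e))" by (rule sum.swap)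
  also have "\<dots> = (\<Sum>e\<in>ind X. card (e \<inter> B))"
    by (intro sum.cong refl) (simp add: sum_of_bool_eq inf_commute)
  finally show ?thesis .
qed

lemma pendant_pair_if_degree_one:
  assumes "x \<in> X" "y \<in> X" "{x, y} \<in> E" "card {u\<in>X. {x, u} \<in> E} \<le> 1"
  shows "pendant_pair X x y"
  using assms card_le_Suc0_iff_eq[of "{u\<in>X. {x, u} \<in> E}"] by (auto simp: pendant_pair_def)

text \<open>Without pendant vertices all non-isolated vertices have degree at least two, so there
  are at least as many edges as such vertices, and a cycle would exist. This leaves three cases for
  the inductions: a cycle vertex, a pendant pair, or no edges.\<close>

lemma acyclic_pendant_free_edgeless:
  assumes "cycle_vertices X = {}" "\<not> (\<exists>x y. pendant_pair X x y)"
  shows "ind X = {}"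
proof (rule ccontr)
  assume "ind X \<noteq> {}"
  then obtain e where e: "e \<in> ind X" by blast
  define B where "B = {x\<in>X. \<exists>y\<in>X. {x, y} \<in> E}"
  have sub: "e \<subseteq> B" if "e \<in> ind X" for e
  proof -
    have "card e = 2" "e \<subseteq> X" "e \<in> E" using ind_edge[OF that] that by (auto simp: induced_edges_def)
    then obtain x y where "e = {x, y}" by (meson card_2_iff)
    then show ?thesis using \<open>e \<subseteq> X\<close> \<open>e \<in> E\<close> by (auto simp: B_def insert_commute)
  qed
  have "2 * card B = (\<Sum>b\<in>B. 2)" by simp
  also have "\<dots> \<le> (\<Sum>b\<in>B. card {u\<in>X. {b, u} \<in> E})"
  proof (rule sum_mono)
    fix b assume "b \<in> B"
    then show "2 \<le> card {u\<in>X. {b, u} \<in> E}"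
      using pendant_pair_if_degree_one assms(2) by (fastforce simp: B_def not_less_eq_eq)
  qed
  also have "\<dots> = (\<Sum>e\<in>ind X. card (e \<inter> B))" by (rule sum_degrees) (auto simp: B_def)
  also have "\<dots> = (\<Sum>e\<in>ind X. 2)"
    using sub ind_edge by (intro sum.cong refl) (simp add: Int_absorb2)
  finally have "card B \<le> card (ind X)" by simp
  moreover have "B \<noteq> {}" using sub[OF e] ind_edge[OF e] by force
  ultimately obtain xs where "is_cycle (ind X) xs"
    using cycle_exists[of B "ind X"] sub ind_edge by auto
  then have xs: "is_cycle E xs" "set xs \<subseteq> X" by (simp_all add: is_cycle_induced_iff)
  then have "set xs \<noteq> {}" by (auto simp: is_cycle_def)
  then show False using xs assms(1) by (auto simp: cycle_vertices_def)
qed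

lemma pendant_not_on_cycle:
  assumes "pendant_pair X x y" shows "x \<notin> cycle_vertices X"
proof
  assume "x \<in> cycle_vertices X"
  then obtain xs where xs: "is_cycle E xs" "set xs \<subseteq> X" "x \<in> set xs"
    by (auto simp: cycle_vertices_def)
  obtain p q where "p \<noteq> q" "p \<in> set xs - {x}" "q \<in> set xs - {x}" "{x, p} \<in> E" "{x, q} \<in> E"
    by (rule cycle_neighbours[OF xs]) (rule that)
  then show False using assms xs(2) unfolding pendant_pair_def by blast
qed

subsection \<open>Null vectors on paths and cycles\<close>

text \<open>The property shared by the real and the Hermitian matrix: opposite entries on an edge
  are inverse to each other. The path and cycle computations use nothing else and serve both
  fields.\<close>

definition edge_weights :: "'a::field ^ 'v ^ 'v \<Rightarrow> bool" where
  "edge_weights M \<longleftrightarrow> (\<forall>u v. {u, v} \<notin> E \<longrightarrow> M$u$v = 0) \<and> (\<forall>u v. {u, v} \<in> E \<longrightarrow> M$u$v * M$v$u = 1)"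

lemma edge_weights_zero: "edge_weights M \<Longrightarrow> {u, v} \<notin> E \<Longrightarrow> M$u$v = 0"
  by (simp add: edge_weights_def)

lemma edge_weights_mult: "edge_weights M \<Longrightarrow> {u, v} \<in> E \<Longrightarrow> M$u$v * M$v$u = 1"
  by (simp add: edge_weights_def)

lemma edge_weights_nonzero: "edge_weights M \<Longrightarrow> {u, v} \<in> E \<Longrightarrow> M$u$v \<noteq> 0"
  using edge_weights_mult[of M u v] by auto

lemma nullity_pendant_pair:
  assumes M: "edge_weights M" and xy: "pendant_pair X x y"
  shows "nullity_on M X = nullity_on M (X - {x, y})"
proof (rule nullity_on_pendant)
  have e: "{x, y} \<in> E" "{y, x} \<in> E" and xyX: "x \<in> X" "y \<in> X"
    using xy by (auto simp: pendant_pair_def insert_commute)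
  show "M$x$y \<noteq> 0" "M$y$x \<noteq> 0" using e edge_weights_nonzero[OF M] by blast+
  show "x \<in> X" "y \<in> X" by fact+
  show "x \<noteq> y" using e edge_ne by blast
  fix u assume u: "u \<in> X" "u \<noteq> y"
  then have "{x, u} \<notin> E" "{u, x} \<notin> E" using xy by (auto simp: pendant_pair_def insert_commute)
  then show "M$x$u = 0" "M$u$x = 0" using edge_weights_zero[OF M] by blast+
qed

lemma nullity_isolated:
  assumes M: "edge_weights M" and v: "v \<in> X" "\<And>u. u \<in> X \<Longrightarrow> {v, u} \<notin> E"
  shows "nullity_on M X = nullity_on M (X - {v}) + 1"
proof (rule nullity_on_remove_isolated[OF v(1)])
  fix u assume "u \<in> X"
  then have "{v, u} \<notin> E" "{u, v} \<notin> E" using v(2) by (auto simp: insert_commute)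
  then show "M$v$u = 0" "M$u$v = 0" using edge_weights_zero[OF M] by blast+
qed

lemma nullity_union:
  assumes M: "edge_weights M" and "X \<inter> Y = {}" and no: "\<And>u v. u \<in> X \<Longrightarrow> v \<in> Y \<Longrightarrow> {u, v} \<notin> E"
  shows "nullity_on M (X \<union> Y) = nullity_on M X + nullity_on M Y"
proof (rule nullity_on_disjoint_union[OF assms(2)])
  fix u v assume "u \<in> X" "v \<in> Y"
  then have "{u, v} \<notin> E" "{v, u} \<notin> E" using no by (auto simp: insert_commute)
  then show "M$u$v = 0" "M$v$u = 0" using edge_weights_zero[OF M] by blast+
qed

text \<open>An end vertex is pendant, so it can be removed with its neighbour; two vertices
  disappear at a time and only the parity of the order remains.\<close>

lemma nullity_path:
  assumes M: "edge_weights M" and "distinct ps"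
    and "\<And>i j. i < j \<Longrightarrow> j < length ps \<Longrightarrow> {ps ! i, ps ! j} \<in> E \<longleftrightarrow> j = Suc i"
  shows "nullity_on M (set ps) = length ps mod 2"
  using assms(2,3)
proof (induction ps rule: length_induct)
  case (1 ps)
  consider "ps = []" | x where "ps = [x]" | x y qs where "ps = x # y # qs"
    by (metis neq_Nil_conv)
  then show ?case
  proof cases
    case 1
    then show ?thesis by simp
  next
    case 2
    then show ?thesis using nullity_isolated[OF M, of x "{x}"] by simp
  next
    case (3 x y qs)
    have "u = y" if u: "u \<in> set ps" "{x, u} \<in> E" for u
    proof -
      obtain j where j: "j < length ps" "u = ps ! j" using u(1) by (metis in_set_conv_nth)
      have "j \<noteq> 0" using j u 3 by (intro notI) simp
      then have "j = Suc 0" using "1.prems"(2)[of 0 j] j u(2) 3 by simp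
      then show ?thesis using j 3 by simp
    qed
    moreover have "{x, y} \<in> E" using "1.prems"(2)[of 0 1] 3 by simp
    ultimately have "pendant_pair (set ps) x y" using 3 by (auto simp: pendant_pair_def)
    then have "nullity_on M (set ps) = nullity_on M (set ps - {x, y})"
      by (rule nullity_pendant_pair[OF M])
    also have "set ps - {x, y} = set qs" using 3 "1.prems"(1) by auto
    also have "nullity_on M (set qs) = length qs mod 2"
    proof -
      have "{qs ! i, qs ! j} \<in> E \<longleftrightarrow> j = Suc i" if "i < j" "j < length qs" for i j
        using "1.prems"(2)[of "Suc (Suc i)" "Suc (Suc j)"] that 3 by simp
      then show ?thesis using "1.IH" "1.prems"(1) 3 by simp
    qed
    finally show ?thesis using 3 by simp
  qed
qed

text \<open>Without chords the remaining vertices, listed from the successor of \<open>v\<close>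
  onwards, form an induced path.\<close>

lemma nullity_cycle_remove:
  assumes M: "edge_weights M" and xs: "is_cycle E xs" and chordless: "ind (set xs) \<subseteq> cycle_edges xs"
    and v: "v \<in> set xs"
  shows "nullity_on M (set xs - {v}) = (length xs - 1) mod 2"
proof -
  let ?l = "length xs" and ?x = "cyc_nth xs"
  have l: "?l \<ge> 3" and dist: "distinct xs" and ne: "xs \<noteq> []" and sub: "cycle_edges xs \<subseteq> E"
    using xs by (auto simp: is_cycle_def)
  have xeq: "?x i = ?x j \<longleftrightarrow> i mod ?l = j mod ?l" for i j by (rule cyc_nth_eq_iff[OF dist ne])
  obtain k where k: "k < ?l" "v = ?x k" using set_eq_cyc_nth[OF v] by blast
  define ps where "ps = map (\<lambda>j. ?x (k + 1 + j)) [0..<?l - 1]"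
  have len: "length ps = ?l - 1" by (simp add: ps_def)
  have nth: "ps ! j = ?x (k + 1 + j)" if "j < ?l - 1" for j using that by (simp add: ps_def)
  have shift: "(k + i) mod ?l \<noteq> (k + j) mod ?l" if "i < j" "j < i + ?l" for i j
  proof
    assume "(k + i) mod ?l = (k + j) mod ?l"
    then have "?l dvd (k + j) - (k + i)"
      by (metis mod_eq_dvd_iff_nat add_le_cancel_left less_imp_le that(1))
    then show False using that by (auto dest: dvd_imp_le)
  qed
  have pdist: "distinct ps"
    unfolding distinct_conv_nth len
  proof (intro allI impI)
    fix i j assume ij: "i < ?l - 1" "j < ?l - 1" "i \<noteq> j"
    then have "i < j \<and> j < i + ?l \<or> j < i \<and> i < j + ?l" by linarith
    then have "(k + (1 + i)) mod ?l \<noteq> (k + (1 + j)) mod ?l"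
      using shift[of "1 + i" "1 + j"] shift[of "1 + j" "1 + i"] by auto
    then show "ps ! i \<noteq> ps ! j" using ij by (simp add: nth xeq)
  qed
  have "ps ! j \<noteq> v" if j: "j < ?l - 1" for j
  proof -
    have "(k + 0) mod ?l \<noteq> (k + (1 + j)) mod ?l" by (rule shift) (use j in linarith)+
    then show ?thesis using j k xeq[of "k + 1 + j" k] by (simp add: nth)
  qed
  then have "v \<notin> set ps" using len by (metis in_set_conv_nth)
  moreover have "set ps \<subseteq> set xs" using ne by (auto simp: ps_def)
  moreover have "card (set ps) = card (set xs - {v})"
    using pdist dist v len by (simp add: distinct_card)
  ultimately have "set ps = set xs - {v}"
    by (intro card_subset_eq) auto
  moreover have "nullity_on M (set ps) = length ps mod 2"
  proof (rule nullity_path[OF M pdist])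
    fix i j assume ij: "i < j" "j < length ps"
    show "{ps ! i, ps ! j} \<in> E \<longleftrightarrow> j = Suc i"
    proof
      assume "{ps ! i, ps ! j} \<in> E"
      then have "{ps ! i, ps ! j} \<in> ind (set xs)"
        using \<open>set ps \<subseteq> set xs\<close> ij by (auto simp: subset_iff)
      then obtain m where "{ps ! i, ps ! j} = {?x m, ?x (Suc m)}"
        using chordless cycle_edges_eq[OF ne] by blast
      then consider "ps ! i = ?x m" "ps ! j = ?x (Suc m)" | "ps ! j = ?x m" "ps ! i = ?x (Suc m)"
        by (auto simp: doubleton_eq_iff)
      then show "j = Suc i"
      proof cases
        case 1
        then have "(k + 1 + i) mod ?l = m mod ?l" "(k + 1 + j) mod ?l = Suc m mod ?l"
          using nth ij len xeq by auto
        then have "(k + (1 + Suc i)) mod ?l = (k + (1 + j)) mod ?l"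
          by (metis add.assoc add_Suc_right mod_Suc_eq)
        moreover have "(k + (1 + Suc i)) mod ?l \<noteq> (k + (1 + j)) mod ?l" if "Suc i < j"
          by (rule shift) (use that ij len in linarith)+
        ultimately show ?thesis using ij by linarith
      next
        case 2
        \<comment> \<open>An edge of the cycle traversed against the order of the list would have to
          wrap around past the missing vertex; \<open>Suc j\<close> exceeds \<open>i\<close> by less
          than \<open>?l\<close>.\<close>
        then have "(k + 1 + j) mod ?l = m mod ?l" "(k + 1 + i) mod ?l = Suc m mod ?l"
          using nth ij len xeq by auto
        then have "(k + (1 + i)) mod ?l = (k + (1 + Suc j)) mod ?l"
          by (metis add.assoc add_Suc_right mod_Suc_eq)
        moreover have "(k + (1 + i)) mod ?l \<noteq> (k + (1 + Suc j)) mod ?l"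
          by (rule shift) (use ij len in linarith)+
        ultimately show ?thesis by blast
      qed
    next
      assume "j = Suc i"
      then have "{ps ! i, ps ! j} = {?x (k + 1 + i), ?x (Suc (k + 1 + i))}" using nth ij len by simp
      then show "{ps ! i, ps ! j} \<in> E" using sub cycle_edges_eq[OF ne] by blast
    qed
  qed
  ultimately show ?thesis using len by simp
qed

definition cycle_weight :: "'a::field ^ 'v ^ 'v \<Rightarrow> 'v list \<Rightarrow> 'a" where
  "cycle_weight M xs = (\<Prod>j<length xs. M $ cyc_nth xs j $ cyc_nth xs (Suc j))"

text \<open>A cycle has length at least three, so the two neighbours are distinct and no term is
  counted twice. The vertex is indexed by \<open>Suc j\<close> so that its predecessor has index
  \<open>j\<close>.\<close>

lemma cycle_row_sum:
  assumes M: "edge_weights M" and xs: "is_cycle E xs" and chordless: "ind (set xs) \<subseteq> cycle_edges xs"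
    and z: "\<forall>u. u \<notin> set xs \<longrightarrow> z$u = 0"
  shows "(\<Sum>v\<in>UNIV. M $ cyc_nth xs (Suc j) $ v * z$v) =
    M $ cyc_nth xs (Suc j) $ cyc_nth xs j * z $ cyc_nth xs j +
    M $ cyc_nth xs (Suc j) $ cyc_nth xs (Suc (Suc j)) * z $ cyc_nth xs (Suc (Suc j))"
proof -
  let ?l = "length xs" and ?x = "cyc_nth xs"
  have l: "?l \<ge> 3" and dist: "distinct xs" and ne: "xs \<noteq> []"
    using xs by (auto simp: is_cycle_def)
  have xeq: "?x i = ?x j \<longleftrightarrow> i mod ?l = j mod ?l" for i j by (rule cyc_nth_eq_iff[OF dist ne])
  have "?x j \<noteq> ?x (Suc (Suc j))"
  proof
    assume "?x j = ?x (Suc (Suc j))"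
    then have "?l dvd Suc (Suc j) - j" unfolding xeq by (metis mod_eq_dvd_iff_nat le_Suc_eq order_refl)
    then show False using l by (auto dest: dvd_imp_le)
  qed
  moreover have "M $ ?x (Suc j) $ v * z$v = 0" if v: "v \<in> UNIV - {?x j, ?x (Suc (Suc j))}" for v
  proof (cases "v \<in> set xs \<and> {?x (Suc j), v} \<in> E")
    case True
    then have "{?x (Suc j), v} \<in> ind (set xs)" using ne by simp
    then obtain m where "{?x (Suc j), v} = {?x m, ?x (Suc m)}"
      using chordless cycle_edges_eq[OF ne] by blast
    then consider "?x (Suc j) = ?x m" "v = ?x (Suc m)" | "?x (Suc j) = ?x (Suc m)" "v = ?x m"
      by (auto simp: doubleton_eq_iff)
    then have "v = ?x (Suc (Suc j)) \<or> v = ?x j"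
    proof cases
      case 1
      then have "Suc (Suc j) mod ?l = Suc m mod ?l" unfolding xeq by (metis mod_Suc_eq)
      then show ?thesis using 1 xeq by simp
    next
      case 2
      then have "(Suc j + (?l - 1)) mod ?l = (Suc m + (?l - 1)) mod ?l"
        unfolding xeq by (metis mod_add_left_eq)
      moreover have "Suc j + (?l - 1) = j + ?l" "Suc m + (?l - 1) = m + ?l" using l by simp_all
      ultimately have "j mod ?l = m mod ?l" by (metis mod_add_self2)
      then show ?thesis using 2 xeq by simp
    qed
    then show ?thesis using v by blast
  next
    case False
    then show ?thesis using z edge_weights_zero[OF M, of "?x (Suc j)" v] by (cases "v \<in> set xs") auto
  qed
  then have "(\<Sum>v\<in>UNIV. M $ ?x (Suc j) $ v * z$v) =
      (\<Sum>v\<in>{?x j, ?x (Suc (Suc j))}. M $ ?x (Suc j) $ v * z$v)"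
    by (intro sum.mono_neutral_right) auto
  ultimately show ?thesis by simp
qed

lemma cycle_weight_factor_nonzero:
  assumes "edge_weights M" "is_cycle E xs"
  shows "M $ cyc_nth xs j $ cyc_nth xs (Suc j) \<noteq> 0"
    "M $ cyc_nth xs (Suc j) $ cyc_nth xs j = inverse (M $ cyc_nth xs j $ cyc_nth xs (Suc j))"
proof -
  have "xs \<noteq> []" "cycle_edges xs \<subseteq> E" using assms(2) by (auto simp: is_cycle_def)
  then have e: "{cyc_nth xs j, cyc_nth xs (Suc j)} \<in> E" using cycle_edges_eq by blast
  show "M $ cyc_nth xs j $ cyc_nth xs (Suc j) \<noteq> 0" by (rule edge_weights_nonzero[OF assms(1) e])
  show "M $ cyc_nth xs (Suc j) $ cyc_nth xs j = inverse (M $ cyc_nth xs j $ cyc_nth xs (Suc j))"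
    using edge_weights_mult[OF assms(1) e] by (simp add: inverse_unique)
qed

text \<open>The equations at consecutive vertices propagate a null vector in steps of two, so going once
  around an even cycle multiplies it by plus or minus the weight of the cycle.\<close>

lemma cycle_weight_of_null_vector:
  assumes M: "edge_weights M" and xs: "is_cycle E xs" and chordless: "ind (set xs) \<subseteq> cycle_edges xs"
    and l: "length xs = 2 * h" and z: "z \<in> null_space_on M (set xs)" "z \<noteq> 0"
  shows "cycle_weight M xs = (-1) ^ h"
proof -
  let ?l = "length xs" and ?x = "cyc_nth xs"
  define w where "w j = M $ ?x j $ ?x (Suc j)" for j
  have w: "w j \<noteq> 0" for j unfolding w_def by (rule cycle_weight_factor_nonzero[OF M xs])
  have ne: "xs \<noteq> []" using xs by (auto simp: is_cycle_def)
  have z0: "\<forall>u. u \<notin> set xs \<longrightarrow> z$u = 0" using z(1) by (simp add: null_space_on_def)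
  have step: "z $ ?x j = - (w j * w (Suc j)) * z $ ?x (Suc (Suc j))" for j
  proof -
    have "(\<Sum>v\<in>UNIV. M $ ?x (Suc j) $ v * z$v) = 0"
      using z(1) ne by (simp add: null_space_on_def)
    then have "inverse (w j) * z $ ?x j + w (Suc j) * z $ ?x (Suc (Suc j)) = 0"
      using cycle_row_sum[OF M xs chordless z0, of j] cycle_weight_factor_nonzero(2)[OF M xs, of j]
      by (simp add: w_def)
    then show ?thesis using w[of j] by (simp add: field_simps eq_neg_iff_add_eq_0)
  qed
  have iter: "z $ ?x j = (-1) ^ k * (\<Prod>i<2 * k. w (j + i)) * z $ ?x (j + 2 * k)" for j k
  proof (induction k)
    case (Suc k)
    have "z $ ?x (j + 2 * k) = - (w (j + 2 * k) * w (Suc (j + 2 * k))) * z $ ?x (j + 2 * Suc k)"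
      using step[of "j + 2 * k"] by simp
    then show ?case using Suc by (simp add: mult_ac)
  qed simp
  \<comment> \<open>The product over a full turn does not depend on the starting point.\<close>
  have shift: "(\<Prod>i<?l. w (j + i)) = cycle_weight M xs" for j
  proof (induction j)
    case 0
    then show ?case by (simp add: cycle_weight_def w_def)
  next
    case (Suc j)
    have "w j * (\<Prod>i<?l. w (Suc j + i)) = (\<Prod>i<Suc ?l. w (j + i))"
      unfolding prod.lessThan_Suc_shift by simp
    also have "\<dots> = (\<Prod>i<?l. w (j + i)) * w (j + ?l)" by simp
    also have "w (j + ?l) = w j"
      unfolding w_def using cyc_nth_add_length[of xs j] cyc_nth_add_length[of xs "Suc j"] by simp
    finally show ?case using Suc w[of j] by simp
  qed
  obtain u where u: "z$u \<noteq> 0" using z(2) by (metis vec_eq_iff zero_index)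
  then have "u \<in> set xs" using z0 by blast
  then obtain j where j: "u = ?x j" using set_eq_cyc_nth[of u xs] by blast
  have "z$u = (-1) ^ h * cycle_weight M xs * z$u"
    using iter[of j h] shift[of j] l j cyc_nth_add_length[of xs j] by simp
  then have "(-1) ^ h * cycle_weight M xs = 1" using u by simp
  then have "(-1) ^ h * ((-1) ^ h * cycle_weight M xs) = (-1) ^ h" by simp
  then show ?thesis by (simp flip: mult.assoc power_mult_distrib)
qed

text \<open>The two-step recursion is solved on the even positions, with zeros on the odd ones. It
  closes up after one turn exactly because of the assumed value of the weight.\<close>

lemma cycle_null_vector_exists:
  assumes M: "edge_weights M" and xs: "is_cycle E xs" and chordless: "ind (set xs) \<subseteq> cycle_edges xs"
    and l: "length xs = 2 * h" and wt: "cycle_weight M xs = (-1) ^ h"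
  shows "\<exists>z\<in>null_space_on M (set xs). z $ cyc_nth xs 0 \<noteq> 0"
proof -
  let ?l = "length xs" and ?x = "cyc_nth xs"
  define w where "w j = M $ ?x j $ ?x (Suc j)" for j
  have w: "w j \<noteq> 0" for j unfolding w_def by (rule cycle_weight_factor_nonzero[OF M xs])
  have ne: "xs \<noteq> []" and dist: "distinct xs" using xs by (auto simp: is_cycle_def)
  have wper: "w (?l + j) = w j" for j
    unfolding w_def using cyc_nth_add_length[of xs j] cyc_nth_add_length[of xs "Suc j"]
    by (simp add: add.commute)
  \<comment> \<open>Unfolding the recursion from the value 1 at position 0 gives these quotients;
    the zeros make the equations at the even positions trivial.\<close>
  define f where "f j = (if even j then (-1) ^ (j div 2) / (\<Prod>i<j. w i) else 0)" for j
  have fstep: "f (Suc (Suc j)) = - f j / (w j * w (Suc j))" for j by (simp add: f_def)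
  have fper: "f (?l + j) = f j" for j
  proof (cases "even j")
    case True
    have "(\<Prod>i<?l + j. w i) = (\<Prod>i<?l. w i) * (\<Prod>i<j. w (?l + i))"
      by (induction j) (simp_all add: mult.assoc)
    also have "(\<Prod>i<?l. w i) = (-1) ^ h" using wt by (simp add: cycle_weight_def w_def)
    also have "(\<Prod>i<j. w (?l + i)) = (\<Prod>i<j. w i)" by (simp only: wper)
    finally show ?thesis using True l by (simp add: f_def power_add)
  qed (simp add: f_def l)
  have fmod: "f (j mod ?l) = f j" for j
  proof -
    have "f (?l * n + i) = f i" for n i
      by (induction n) (simp_all add: fper add.assoc)
    from this[of "j div ?l" "j mod ?l"] show ?thesis by simp
  qed
  \<comment> \<open>Any index of a vertex would do, by the periodicity of \<open>f\<close>; the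
    choice takes the one below \<open>?l\<close>.\<close>
  define z where "z = (\<chi> v. if v \<in> set xs then f (SOME j. j < ?l \<and> v = ?x j) else 0)"
  have zx: "z $ ?x j = f j" for j
  proof -
    let ?i = "SOME i. i < ?l \<and> ?x j = ?x i"
    have "\<exists>i. i < ?l \<and> ?x j = ?x i" using set_eq_cyc_nth[of "?x j" xs] ne by simp
    then have "?i < ?l \<and> ?x j = ?x ?i" by (rule someI_ex)
    then have "j mod ?l = ?i" using cyc_nth_eq_iff[OF dist ne] by auto
    then show ?thesis using fmod[of j] ne by (simp add: z_def)
  qed
  have z0: "\<forall>u. u \<notin> set xs \<longrightarrow> z$u = 0" by (simp add: z_def)
  have "(\<Sum>v\<in>UNIV. M$u$v * z$v) = 0" if u: "u \<in> set xs" for u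
  proof -
    obtain i where "u = ?x i" using set_eq_cyc_nth[OF u] by blast
    \<comment> \<open>One full turn is added so that the index of \<open>u\<close> is certainly a
      successor.\<close>
    then have "u = ?x (Suc (i + ?l - 1))"
      using cyc_nth_add_length[of xs i] ne by simp
    then obtain j where j: "u = ?x (Suc j)" by blast
    have "(\<Sum>v\<in>UNIV. M$u$v * z$v) = M $ ?x (Suc j) $ ?x j * f j + w (Suc j) * f (Suc (Suc j))"
      unfolding j using cycle_row_sum[OF M xs chordless z0, of j] by (simp only: zx w_def)
    also have "M $ ?x (Suc j) $ ?x j = inverse (w j)"
      unfolding w_def by (rule cycle_weight_factor_nonzero(2)[OF M xs])
    finally show ?thesis using w[of j] w[of "Suc j"] by (simp add: fstep field_simps)
  qed
  then have "z \<in> null_space_on M (set xs)" using z0 by (simp add: null_space_on_def)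
  moreover have "z $ ?x 0 \<noteq> 0" unfolding zx by (simp add: f_def)
  ultimately show ?thesis by blast
qed

lemma cyclomatic_isolated:
  assumes "\<And>u. u \<in> X \<Longrightarrow> {v, u} \<notin> E"
  shows "cyclomatic (X - {v}) = cyclomatic X"
proof -
  have "ind X \<subseteq> ind (X - {v})"
  proof
    fix e assume e: "e \<in> ind X"
    then have "card e = 2" using ind_edge[OF e] by simp
    then obtain s t where "e = {s, t}" by (meson card_2_iff)
    then show "e \<in> ind (X - {v})" using e assms[of t] assms[of s] by (auto simp: insert_commute)
  qed
  then have "ind (X - {v}) = ind X" using induced_edges_mono[of "X - {v}" X E] by blast
  then have "cyclomatic (X - {v}) = cyclomatic_number X (ind X)" using cyclomatic_remove[of X v] by simp
  then show ?thesis by (simp add: cyclomatic_def[of X])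
qed

subsection \<open>Bridges\<close>

definition bridge :: "'v set \<Rightarrow> 'v \<Rightarrow> 'v \<Rightarrow> bool" where
  "bridge X a b \<longleftrightarrow> a \<in> X \<and> b \<in> X \<and> {a, b} \<in> E
     \<and> \<not> (\<exists>xs. is_cycle E xs \<and> set xs \<subseteq> X \<and> {a, b} \<in> cycle_edges xs)"

text \<open>When the edge between \<open>b\<close> and \<open>a\<close> is a bridge, this is the
  whole side of \<open>a\<close>. The deleted end \<open>b\<close> comes first.\<close>

definition branch :: "'v set \<Rightarrow> 'v \<Rightarrow> 'v \<Rightarrow> 'v set" where
  "branch X b a = {u. (a, u) \<in> edge_conn (ind (X - {b}))}"

lemma bridge_sym: "bridge X a b \<longleftrightarrow> bridge X b a"
  by (auto simp: bridge_def insert_commute)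

lemma branch_subset:
  assumes "bridge X b a" shows "branch X b a \<subseteq> X - {b}"
proof
  fix u assume "u \<in> branch X b a"
  then have u: "(a, u) \<in> edge_conn (ind (X - {b}))" by (simp add: branch_def)
  have "a \<in> X - {b}" using assms edge_ne[of b a] by (auto simp: bridge_def insert_commute)
  then show "u \<in> X - {b}" by (rule edge_conn_closed[OF u])
qed

text \<open>A walk that starts at \<open>c\<close> and avoids \<open>e\<close> stays in the branch
  behind \<open>c\<close>; it never meets \<open>b\<close> and so also lives in the graph without
  \<open>b\<close>.\<close>

lemma branch_subset_branch:
  assumes b: "b \<notin> branch X e c" and c: "c \<in> branch X b a"
  shows "branch X e c \<subseteq> branch X b a"
proof
  fix u assume "u \<in> branch X e c"
  then have u: "(c, u) \<in> {(x, y). {x, y} \<in> ind (X - {e})}\<^sup>*" by (simp add: branch_def edge_conn_def)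
  then have "(c, u) \<in> edge_conn (ind (X - {b}))"
  proof (induction rule: rtrancl_induct)
    case base
    then show ?case by simp
  next
    case (step y z)
    have y: "y \<in> branch X e c" using step.hyps(1) by (simp add: branch_def edge_conn_def)
    have yz: "{y, z} \<in> ind (X - {e})" using step.hyps(2) by simp
    then have "z \<in> branch X e c" using y edge_conn_edge[OF yz] edge_conn_trans
      unfolding branch_def by fast
    then have "{y, z} \<in> ind (X - {b})" using y yz b by auto
    then show ?case using step.IH edge_conn_edge edge_conn_trans by metis
  qed
  moreover have "(a, c) \<in> edge_conn (ind (X - {b}))" using c by (simp add: branch_def)
  ultimately show "u \<in> branch X b a" unfolding branch_def using edge_conn_trans by fast
qed

text \<open>A common vertex would connect \<open>a\<close> to \<open>b\<close> without using their
  edge, which would then lie on a cycle.\<close>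

lemma branches_disjoint:
  assumes "bridge X a b" shows "branch X b a \<inter> branch X a b = {}"
proof (rule ccontr)
  assume "branch X b a \<inter> branch X a b \<noteq> {}"
  then obtain z where z: "(a, z) \<in> edge_conn (ind (X - {b}))" "(b, z) \<in> edge_conn (ind (X - {a}))"
    by (auto simp: branch_def)
  have "ind (X - {b}) \<subseteq> ind X - {{a, b}}" "ind (X - {a}) \<subseteq> ind X - {{a, b}}"
    by (auto simp: induced_edges_def)
  then have "(a, z) \<in> edge_conn (ind X - {{a, b}})" "(b, z) \<in> edge_conn (ind X - {{a, b}})"
    using z edge_conn_mono by blast+
  then have "(a, b) \<in> edge_conn (ind X - {{a, b}})" using edge_conn_sym edge_conn_trans by metis
  moreover have "{a, b} \<in> ind X" "a \<noteq> b" using assms edge_ne[of a b] by (auto simp: bridge_def)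
  ultimately show False
    using cycle_through_edge[of a b "ind X"] assms by (auto simp: bridge_def is_cycle_induced_iff)
qed

end

section \<open>Tight subgraphs\<close>

locale rank_gap = finite_graph E for E :: "('v::finite) set set" +
  fixes A :: "real ^ 'v ^ 'v" and H :: "complex ^ 'v ^ 'v"
  assumes adjacency: "A$u$v = (if {u, v} \<in> E then 1 else 0)"
    and weights_H: "edge_weights H"
begin

lemma weights_A: "edge_weights A"
  by (simp add: edge_weights_def adjacency insert_commute)

text \<open>By rank-nullity this is the rank of \<open>H\<close> minus the rank of \<open>A\<close> on \<open>X\<close>.\<close>

definition gap :: "'v set \<Rightarrow> int" where
  "gap X = int (nullity_on A X) - int (nullity_on H X)"

definition tight :: "'v set \<Rightarrow> bool" where
  "tight X \<longleftrightarrow> gap X = 2 * cyclomatic X"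

lemma gap_remove_le: "v \<in> X \<Longrightarrow> gap X \<le> gap (X - {v}) + 2"
  using nullity_on_remove_le[of v X A] nullity_on_remove_ge[of v X H] by (simp add: gap_def)

lemma gap_pendant: "pendant_pair X x y \<Longrightarrow> gap X = gap (X - {x, y})"
  using nullity_pendant_pair[OF weights_A] nullity_pendant_pair[OF weights_H] by (simp add: gap_def)

lemma gap_isolated:
  assumes "v \<in> X" "\<And>u. u \<in> X \<Longrightarrow> {v, u} \<notin> E"
  shows "gap X = gap (X - {v})"
  using nullity_isolated[OF weights_A assms] nullity_isolated[OF weights_H assms] by (simp add: gap_def)

lemma gap_union:
  assumes "X \<inter> Y = {}" "\<And>u v. u \<in> X \<Longrightarrow> v \<in> Y \<Longrightarrow> {u, v} \<notin> E"
  shows "gap (X \<union> Y) = gap X + gap Y"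
  using nullity_union[OF weights_A assms] nullity_union[OF weights_H assms] by (simp add: gap_def)

lemma gap_empty [simp]: "gap {} = 0"
  by (simp add: gap_def)

lemma gap_edgeless:
  assumes "ind X = {}" shows "gap X = 0"
proof -
  have "finite X" by simp
  then show ?thesis using assms
  proof (induction X rule: finite_induct)
    case (insert v X)
    have "{v, u} \<notin> E" if "u \<in> insert v X" for u
      using insert.prems that induced_edge_iff[of v u E "insert v X"] by auto
    then have "gap (insert v X) = gap (insert v X - {v})" by (intro gap_isolated) auto
    moreover have "ind X = {}" using insert.prems induced_edges_mono[of X "insert v X" E] by auto
    ultimately show ?case using insert by simp
  qed simp
qed

lemma gap_le: "gap X \<le> 2 * cyclomatic X"
proof (induction "card X" arbitrary: X rule: less_induct)
  case less
  consider v where "v \<in> cycle_vertices X" | x y where "pendant_pair X x y" | "ind X = {}"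
    using acyclic_pendant_free_edgeless by blast
  then show ?case
  proof cases
    case (1 v)
    then have v: "v \<in> X" using cycle_vertices_subset by blast
    then have "card (X - {v}) < card X" by (intro card_Diff1_less) auto
    then have "gap (X - {v}) \<le> 2 * cyclomatic (X - {v})" by (rule less)
    then show ?thesis using gap_remove_le[OF v] cyclomatic_remove_cycle_vertex[OF 1] by linarith
  next
    case (2 x y)
    then have "x \<in> X" by (simp add: pendant_pair_def)
    then have "card (X - {x, y}) < card X" by (intro psubset_card_mono) auto
    then have "gap (X - {x, y}) \<le> 2 * cyclomatic (X - {x, y})" by (rule less)
    then show ?thesis
      using gap_pendant[OF 2] cyclomatic_mono[of "X - {x, y}" X] by simp
  next
    case 3
    then show ?thesis using gap_edgeless cyclomatic_nonneg[of X] by simp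
  qed
qed

text \<open>In \<open>gap X \<le> gap (X - {v}) + 2 \<le> 2 * cyclomatic (X - {v}) + 2 \<le> 2 *
  cyclomatic X\<close> the outer terms agree, so equality holds throughout. A drop of the gap by two
  then requires both nullities to move by one, in opposite directions.\<close>

lemma tight_remove:
  assumes "tight X" "v \<in> cycle_vertices X"
  shows "tight (X - {v})" "cyclomatic X = cyclomatic (X - {v}) + 1"
    "nullity_on A X = nullity_on A (X - {v}) + 1"
proof -
  have v: "v \<in> X" using assms(2) cycle_vertices_subset by blast
  note facts = gap_remove_le[OF v] cyclomatic_remove_cycle_vertex[OF assms(2)] gap_le[of "X - {v}"]
    assms(1)[unfolded tight_def]
  show "tight (X - {v})" "cyclomatic X = cyclomatic (X - {v}) + 1"
    using facts by (auto simp: tight_def)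
  have "gap X = gap (X - {v}) + 2" using facts by linarith
  then show "nullity_on A X = nullity_on A (X - {v}) + 1"
    using nullity_on_remove_le[OF v, of A] nullity_on_remove_ge[OF v, of H] by (simp add: gap_def)
qed

text \<open>The gap is unchanged, so \<open>d\<close> must not drop either; deleting a neighbour
  \<open>y\<close> that lies on a cycle would lower it.\<close>

lemma tight_pendant:
  assumes "tight X" "pendant_pair X x y"
  shows "tight (X - {x, y})" "cyclomatic (X - {x, y}) = cyclomatic X"
    "cycle_vertices (X - {x, y}) = cycle_vertices X" "y \<notin> cycle_vertices X"
proof -
  note facts = gap_pendant[OF assms(2)] cyclomatic_mono[of "X - {x, y}" X] gap_le[of "X - {x, y}"]
    assms(1)[unfolded tight_def]
  show "tight (X - {x, y})" "cyclomatic (X - {x, y}) = cyclomatic X"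
    using facts by (auto simp: tight_def)
  show y: "y \<notin> cycle_vertices X"
  proof
    assume "y \<in> cycle_vertices X"
    then have "cyclomatic (X - {y}) + 1 \<le> cyclomatic X" by (rule cyclomatic_remove_cycle_vertex)
    moreover have "cyclomatic (X - {x, y}) \<le> cyclomatic (X - {y})" by (rule cyclomatic_mono) auto
    ultimately show False using facts by auto
  qed
  have "set xs \<subseteq> X - {x, y}" if "is_cycle E xs" "set xs \<subseteq> X" for xs
    using that y pendant_not_on_cycle[OF assms(2)] by (auto simp: cycle_vertices_def)
  then show "cycle_vertices (X - {x, y}) = cycle_vertices X"
    unfolding cycle_vertices_def by blast
qed

lemma tight_isolated:
  assumes "tight X" "v \<in> X" "\<And>u. u \<in> X \<Longrightarrow> {v, u} \<notin> E"
  shows "tight (X - {v})"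
  using assms(1) gap_isolated[OF assms(2,3)] cyclomatic_isolated[OF assms(3)] by (simp add: tight_def)

lemma tight_neighbours:
  assumes "tight X" "v \<in> cycle_vertices X"
    and "a \<noteq> b" "a \<in> X" "b \<in> X" "{v, a} \<in> E" "{v, b} \<in> E" "(a, b) \<in> edge_conn (ind (X - {v}))"
    and "c \<noteq> d" "c \<in> X" "d \<in> X" "{v, c} \<in> E" "{v, d} \<in> E" "(c, d) \<in> edge_conn (ind (X - {v}))"
  shows "{a, b} = {c, d}"
proof (rule ccontr)
  assume "{a, b} \<noteq> {c, d}"
  moreover have "v \<in> X" using assms(2) cycle_vertices_subset by blast
  ultimately have "cyclomatic (X - {v}) + 2 \<le> cyclomatic X"
    using assms by (intro cyclomatic_remove_two_cycles[of v X a b c d])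
  then show False using tight_remove(2)[OF assms(1,2)] by linarith
qed

lemma in_cycle_vertices: "is_cycle E xs \<Longrightarrow> set xs \<subseteq> X \<Longrightarrow> v \<in> set xs \<Longrightarrow> v \<in> cycle_vertices X"
  by (auto simp: cycle_vertices_def)

section \<open>Cycles inside a tight subgraph\<close>

lemma tight_cycle_edges_at:
  assumes X: "tight X" and xs: "is_cycle E xs" "set xs \<subseteq> X" and ys: "is_cycle E ys" "set ys \<subseteq> X"
    and s: "s \<in> set xs" "s \<in> set ys"
  shows "{s, u} \<in> cycle_edges xs \<longleftrightarrow> {s, u} \<in> cycle_edges ys"
proof -
  obtain p q where pq: "p \<noteq> q" "p \<in> set xs - {s}" "q \<in> set xs - {s}" "{s, p} \<in> E" "{s, q} \<in> E"
    "\<And>u. {s, u} \<in> cycle_edges xs \<longleftrightarrow> u = p \<or> u = q" "(p, q) \<in> edge_conn (ind (X - {s}))"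
    by (rule cycle_neighbours[OF xs s(1)]) (rule that)
  obtain a b where ab: "a \<noteq> b" "a \<in> set ys - {s}" "b \<in> set ys - {s}" "{s, a} \<in> E" "{s, b} \<in> E"
    "\<And>u. {s, u} \<in> cycle_edges ys \<longleftrightarrow> u = a \<or> u = b" "(a, b) \<in> edge_conn (ind (X - {s}))"
    by (rule cycle_neighbours[OF ys s(2)]) (rule that)
  have "{p, q} = {a, b}"
    using pq ab xs ys by (intro tight_neighbours[OF X in_cycle_vertices[OF xs s(1)]]) auto
  then show ?thesis unfolding pq(6) ab(6) by (auto simp: doubleton_eq_iff)
qed

text \<open>From a common vertex on, every step along \<open>xs\<close> uses an edge of
  \<open>ys\<close> and therefore ends at a vertex of \<open>ys\<close>.\<close>

lemma tight_cycle_subset: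
  assumes X: "tight X" and xs: "is_cycle E xs" "set xs \<subseteq> X" and ys: "is_cycle E ys" "set ys \<subseteq> X"
    and meet: "set xs \<inter> set ys \<noteq> {}"
  shows "set xs \<subseteq> set ys \<and> cycle_edges xs \<subseteq> cycle_edges ys"
proof -
  let ?x = "cyc_nth xs" and ?l = "length xs"
  have ne: "xs \<noteq> []" using xs by (auto simp: is_cycle_def)
  have edge: "{?x j, ?x (Suc j)} \<in> cycle_edges xs" for j unfolding cycle_edges_eq[OF ne] by blast
  have step: "{?x j, ?x (Suc j)} \<in> cycle_edges ys" if "?x j \<in> set ys" for j
    using tight_cycle_edges_at[OF X xs ys _ that, of "?x (Suc j)"] edge[of j] ne by simp
  obtain k where k: "k < ?l" "?x k \<in> set ys" using meet set_eq_cyc_nth by (metis disjoint_iff)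
  have on: "?x (k + n) \<in> set ys" for n
  proof (induction n)
    case (Suc n)
    then show ?case using cycle_edges_subset[OF step[OF Suc]] by simp
  qed (use k in simp)
  have all: "?x i \<in> set ys" for i
  proof -
    \<comment> \<open>Adding \<open>k\<close> full turns puts index \<open>i\<close> at or beyond
      \<open>k\<close>, where \<open>on\<close> applies.\<close>
    have "i + k * ?l = k + (i + k * ?l - k)" using k by (simp add: trans_le_add2)
    moreover have "?x (i + k * ?l) = ?x i" by (simp add: cyc_nth_def)
    ultimately show ?thesis using on by metis
  qed
  then have "set xs \<subseteq> set ys" using set_eq_cyc_nth by (metis subsetI)
  moreover have "cycle_edges xs \<subseteq> cycle_edges ys" unfolding cycle_edges_eq[OF ne] using step all by blast
  ultimately show ?thesis by blast
qed

lemma tight_cycle_unique: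
  assumes "tight X" "is_cycle E xs" "set xs \<subseteq> X" "is_cycle E ys" "set ys \<subseteq> X" "set xs \<inter> set ys \<noteq> {}"
  shows "set xs = set ys" "cycle_edges xs = cycle_edges ys"
  using tight_cycle_subset[OF assms] tight_cycle_subset[OF assms(1,4,5,2,3)] assms(6) by auto

text \<open>If \<open>c\<close> could return to the cycle outside \<open>s\<close>, then
  \<open>c\<close> and a cycle neighbour of \<open>s\<close> would be a second pair of neighbours
  connected outside \<open>s\<close>.\<close>

lemma tight_cycle_other_neighbour:
  assumes X: "tight X" and xs: "is_cycle E xs" "set xs \<subseteq> X" and s: "s \<in> set xs"
    and c: "c \<in> X" "{s, c} \<in> E" "{s, c} \<notin> cycle_edges xs"
  shows "bridge X s c" "c \<notin> set xs"
    "\<And>t. t \<in> set xs - {s} \<Longrightarrow> (c, t) \<notin> edge_conn (ind (X - {s}))"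
proof -
  obtain p q where pq: "p \<noteq> q" "p \<in> set xs - {s}" "q \<in> set xs - {s}" "{s, p} \<in> E" "{s, q} \<in> E"
    "\<And>u. {s, u} \<in> cycle_edges xs \<longleftrightarrow> u = p \<or> u = q"
    "\<And>t. t \<in> set xs - {s} \<Longrightarrow> (p, t) \<in> edge_conn (ind (X - {s}))"
    "(p, q) \<in> edge_conn (ind (X - {s}))"
    by (rule cycle_neighbours[OF xs s]) (rule that)
  have cpq: "c \<noteq> p" "c \<noteq> q" using c pq(6)[of c] by auto
  show nc: "(c, t) \<notin> edge_conn (ind (X - {s}))" if t: "t \<in> set xs - {s}" for t
  proof
    assume "(c, t) \<in> edge_conn (ind (X - {s}))"
    then have "(p, c) \<in> edge_conn (ind (X - {s}))"
      using pq(7)[OF t] edge_conn_sym edge_conn_trans by metis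
    then have "{p, q} = {p, c}"
      using pq cpq c xs by (intro tight_neighbours[OF X in_cycle_vertices[OF xs s]]) auto
    then show False using cpq pq(1) by (auto simp: doubleton_eq_iff)
  qed
  have "c \<noteq> s" using c edge_ne by blast
  then show "c \<notin> set xs" using nc[of c] by auto
  show "bridge X s c"
    unfolding bridge_def
  proof (intro conjI notI)
    assume "\<exists>ys. is_cycle E ys \<and> set ys \<subseteq> X \<and> {s, c} \<in> cycle_edges ys"
    then obtain ys where ys: "is_cycle E ys" "set ys \<subseteq> X" "{s, c} \<in> cycle_edges ys" by blast
    then have "s \<in> set ys" using cycle_edges_subset[of "{s, c}" ys] by auto
    then have "cycle_edges xs = cycle_edges ys" using tight_cycle_unique(2)[OF X xs ys(1,2)] s by blast
    then show False using ys c by blast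
  qed (use c xs s in auto)
qed

lemma tight_chordless:
  assumes "tight X" "is_cycle E xs" "set xs \<subseteq> X"
  shows "ind (set xs) \<subseteq> cycle_edges xs"
proof
  fix e assume e: "e \<in> ind (set xs)"
  then have "card e = 2" using ind_edge[OF e] by simp
  then obtain s c where sc: "e = {s, c}" by (meson card_2_iff)
  then have "s \<in> set xs" "c \<in> set xs" "{s, c} \<in> E" using e by auto
  then show "e \<in> cycle_edges xs"
    using tight_cycle_other_neighbour(2)[OF assms, of s c] assms(3) sc by blast
qed

text \<open>The search moves away from \<open>b\<close> through bridges with ever smaller branches.
  At a vertex off all cycles there is another neighbour, as no vertex is pendant, and the edge to it
  is again a bridge. At a cycle, either the edge to \<open>b\<close> is its only exit, or another
  exit is a bridge to follow.\<close>

lemma leaf_cycle_exists: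
  assumes X: "tight X" and free: "\<not> (\<exists>x y. pendant_pair X x y)" and ba: "bridge X b a"
  shows "\<exists>xs v w. is_cycle E xs \<and> set xs \<subseteq> branch X b a \<and> v \<in> set xs \<and> w \<in> X - set xs \<and> {v, w} \<in> E
    \<and> (\<forall>s\<in>set xs. \<forall>c\<in>X - set xs. {s, c} \<in> E \<longrightarrow> s = v \<and> c = w)"
  using ba
proof (induction "card (branch X b a)" arbitrary: a b rule: less_induct)
  case less
  have ab: "a \<in> X" "b \<in> X" "{b, a} \<in> E" "{a, b} \<in> E" "a \<noteq> b"
    using less.prems edge_ne[of a b] by (auto simp: bridge_def insert_commute)
  have aA: "a \<in> branch X b a" by (simp add: branch_def)
  \<comment> \<open>The branch behind the new bridge is strictly smaller because it misses
    \<open>e\<close>.\<close>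
  have descend: ?case
    if "bridge X e c" "b \<notin> branch X e c" "c \<in> branch X b a" "e \<in> branch X b a" for e c
  proof -
    have "branch X e c \<subseteq> branch X b a" using that branch_subset_branch by blast
    moreover have "e \<notin> branch X e c" using branch_subset[OF that(1)] by blast
    ultimately have sub: "branch X e c \<subset> branch X b a" using that(4) by blast
    then have "card (branch X e c) < card (branch X b a)" by (intro psubset_card_mono) auto
    from less.hyps[OF this that(1)] show ?thesis using sub by blast
  qed
  have inA: "c \<in> branch X b a" if "e \<in> branch X b a" "{e, c} \<in> E" "c \<in> X" "c \<noteq> b" for e c
  proof -
    have "e \<in> X - {b}" using branch_subset[OF less.prems] that by blast
    then have "{e, c} \<in> ind (X - {b})" using that by auto
    then have "(e, c) \<in> edge_conn (ind (X - {b}))" by (rule edge_conn_edge)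
    then show ?thesis using that(1) unfolding branch_def by (auto intro: edge_conn_trans)
  qed
  show ?case
  proof (cases "a \<in> cycle_vertices X")
    case False
    have "\<not> pendant_pair X a b" using free by blast
    then obtain c where c: "c \<in> X" "{a, c} \<in> E" "c \<noteq> b"
      using ab by (auto simp: pendant_pair_def)
    have "bridge X a c"
      unfolding bridge_def using ab c False vertex_on_cycle[of a "{a, c}" _ X] by blast
    moreover have "b \<notin> branch X a c"
    proof
      assume "b \<in> branch X a c"
      then have "(c, b) \<in> edge_conn (ind (X - {a}))" by (simp add: branch_def)
      then obtain xs where "is_cycle E xs" "set xs \<subseteq> X" "{a, c} \<in> cycle_edges xs"
        using cycle_of_connected_neighbours[of a X c b] ab c by blast
      then show False using False vertex_on_cycle[of a "{a, c}" xs X] by blast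
    qed
    ultimately show ?thesis using descend inA[OF aA c(2,1,3)] aA by blast
  next
    case True
    then obtain xs where xs: "is_cycle E xs" "set xs \<subseteq> X" "a \<in> set xs"
      by (auto simp: cycle_vertices_def)
    have nb: "{a, b} \<notin> cycle_edges xs"
      using less.prems xs by (auto simp: bridge_def insert_commute)
    note other_ab = tight_cycle_other_neighbour[OF X xs ab(2,4) nb]
    have xsA: "set xs \<subseteq> branch X b a"
    proof
      fix s assume s: "s \<in> set xs"
      obtain p q where pq: "p \<in> set xs - {a}" "{a, p} \<in> E"
        "\<And>t. t \<in> set xs - {a} \<Longrightarrow> (p, t) \<in> edge_conn (induced_edges E (set xs - {a}))"
      proof -
        have sub: "cycle_edges xs \<subseteq> E" using xs(1) by (simp add: is_cycle_def)
        show ?thesis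
          by (rule is_cycle_neighbours[OF xs(1,3)], rule that) (use sub in blast)+
      qed
      show "s \<in> branch X b a"
      proof (cases "s = a")
        case False
        have "edge_conn (ind (set xs - {a})) \<subseteq> edge_conn (ind (X - {b}))"
          using xs(2) other_ab(2) by (intro edge_conn_mono induced_edges_mono) auto
        then have "(p, s) \<in> edge_conn (ind (X - {b}))" using pq(3)[of s] s False by blast
        moreover have "p \<in> branch X b a"
          using inA[OF aA pq(2)] pq(1) xs(2) other_ab(2) by blast
        ultimately show ?thesis unfolding branch_def by (auto intro: edge_conn_trans)
      qed (use aA in simp)
    qed
    show ?thesis
    proof (cases "\<forall>s\<in>set xs. \<forall>c\<in>X - set xs. {s, c} \<in> E \<longrightarrow> s = a \<and> c = b")
      case True
      then show ?thesis using xs xsA ab other_ab(2) by blast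
    next
      case False
      then obtain e c where ec: "e \<in> set xs" "c \<in> X" "c \<notin> set xs" "{e, c} \<in> E" "\<not> (e = a \<and> c = b)"
        by blast
      have "{e, c} \<notin> cycle_edges xs" using ec(3) cycle_edges_subset[of "{e, c}" xs] by blast
      note other = tight_cycle_other_neighbour[OF X xs(1,2) ec(1,2,4) this]
      \<comment> \<open>If \<open>b\<close> lay behind the exit from \<open>e\<close> to
        \<open>c\<close>, then for \<open>e = a\<close> the neighbours \<open>b\<close> and
        \<open>c\<close> would form a second connected pair at \<open>a\<close>; for
        \<open>e \<noteq> a\<close> the walk through \<open>b\<close> to \<open>a\<close> would
        return to the cycle outside \<open>e\<close>.\<close>
      have bA: "b \<notin> branch X e c"
      proof
        assume b: "b \<in> branch X e c"
        then have cb: "(c, b) \<in> edge_conn (ind (X - {e}))" by (simp add: branch_def)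
        show False
        proof (cases "e = a")
          case True
          then have "c \<noteq> b" using ec by blast
          obtain p q where pq: "p \<noteq> q" "p \<in> set xs - {a}" "q \<in> set xs - {a}" "{a, p} \<in> E" "{a, q} \<in> E"
            "(p, q) \<in> edge_conn (ind (X - {a}))"
            by (rule cycle_neighbours[OF xs]) (rule that)
          have "{c, b} = {p, q}"
            using True cb \<open>c \<noteq> b\<close> ec ab pq xs
            by (intro tight_neighbours[OF X in_cycle_vertices[OF xs]]) auto
          then show False using pq ec by (auto simp: doubleton_eq_iff)
        next
          case False
          have "{b, a} \<in> ind (X - {e})" using False ab other_ab(2) ec(1) by auto
          then have "(c, a) \<in> edge_conn (ind (X - {e}))"
            using cb edge_conn_edge edge_conn_trans by metis
          then show False using other(3)[of a] xs(3) False by blast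
        qed
      qed
      moreover have "c \<noteq> b" using bA by (auto simp: branch_def)
      then have "c \<in> branch X b a" using inA[of e c] xsA ec by blast
      ultimately show ?thesis using descend[OF other(1)] xsA ec(1) by blast
    qed
  qed
qed

section \<open>The gap of a single cycle\<close>

lemma nullity_cycle_le:
  assumes "edge_weights M" "is_cycle E xs" "ind (set xs) \<subseteq> cycle_edges xs"
  shows "nullity_on M (set xs) \<le> (length xs - 1) mod 2 + 1"
proof -
  have v: "cyc_nth xs 0 \<in> set xs" using assms(2) by (intro cyc_nth_in_set) (auto simp: is_cycle_def)
  show ?thesis using nullity_on_remove_le[OF v, of M] nullity_cycle_remove[OF assms v] by simp
qed

lemma cycle_weight_adjacency:
  assumes "is_cycle E xs" shows "cycle_weight A xs = 1"
proof -
  have "xs \<noteq> []" "cycle_edges xs \<subseteq> E" using assms by (auto simp: is_cycle_def)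
  then have "{cyc_nth xs j, cyc_nth xs (Suc j)} \<in> E" for j using cycle_edges_eq by blast
  then show ?thesis by (simp add: cycle_weight_def adjacency)
qed

text \<open>The real nullity is at most two, so a gap of two means real nullity two and Hermitian
  nullity zero. A null vector of an even cycle of length \<open>2 * h\<close> needs weight
  \<open>(-1) ^ h\<close>; the real weight is 1, which makes \<open>h\<close> even, and then the
  Hermitian weight has to differ from 1.\<close>

lemma gap_cycle_eq_2_iff:
  assumes xs: "is_cycle E xs" and chordless: "ind (set xs) \<subseteq> cycle_edges xs"
  shows "gap (set xs) = 2 \<longleftrightarrow> 4 dvd length xs \<and> cycle_weight H xs \<noteq> 1"
proof -
  let ?v = "cyc_nth xs 0"
  have l: "length xs \<ge> 3" using xs by (simp add: is_cycle_def)
  have v: "?v \<in> set xs" using l by (intro cyc_nth_in_set) auto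
  note leA = nullity_cycle_le[OF weights_A xs chordless]
  show ?thesis
  proof
    assume gap: "gap (set xs) = 2"
    have "nullity_on A (set xs) \<ge> 2" using gap by (simp add: gap_def)
    then have "(length xs - 1) mod 2 = 1" using leA by linarith
    then have "even (length xs)" using l by presburger
    then obtain h where h: "length xs = 2 * h" by blast
    have nH: "nullity_on H (set xs) = 0" and nA: "nullity_on A (set xs) \<noteq> 0"
      using gap leA \<open>(length xs - 1) mod 2 = 1\<close> by (simp_all add: gap_def)
    obtain z where "z \<in> null_space_on A (set xs)" "z \<noteq> 0"
      by (rule bexE[OF nullity_on_nonzero[OF nA]])
    then have "(-1::real) ^ h = 1"
      using cycle_weight_of_null_vector[OF weights_A xs chordless h] cycle_weight_adjacency[OF xs] by simp
    then have "even h" by (metis minus_one_power_iff one_neq_neg_one)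
    then have "4 dvd length xs" using h by auto
    moreover have "cycle_weight H xs \<noteq> 1"
    proof
      assume "cycle_weight H xs = 1"
      then have "cycle_weight H xs = (-1) ^ h" using \<open>even h\<close> by simp
      then obtain z where "z \<in> null_space_on H (set xs)" "z $ ?v \<noteq> 0"
        by (rule bexE[OF cycle_null_vector_exists[OF weights_H xs chordless h]])
      then show False using nH unfolding nullity_on_eq_0_iff by auto
    qed
    ultimately show "4 dvd length xs \<and> cycle_weight H xs \<noteq> 1" by blast
  next
    assume *: "4 dvd length xs \<and> cycle_weight H xs \<noteq> 1"
    then obtain k where k: "length xs = 4 * k" by blast
    then have h: "length xs = 2 * (2 * k)" by simp
    have "cycle_weight A xs = (-1) ^ (2 * k)" using cycle_weight_adjacency[OF xs] by simp
    then obtain z where z: "z \<in> null_space_on A (set xs)" "z $ ?v \<noteq> 0"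
      by (rule bexE[OF cycle_null_vector_exists[OF weights_A xs chordless h]])
    \<comment> \<open>The null vector is nonzero at \<open>?v\<close>, so the nullity is one more
      than that of the path left after deleting \<open>?v\<close>, which has odd order.\<close>
    have "A$u$w = A$w$u" for u w by (simp add: adjacency insert_commute)
    then have "nullity_on A (set xs) = nullity_on A (set xs - {?v}) + 1"
      by (rule nullity_on_remove_supported[OF v z])
    also have "nullity_on A (set xs - {?v}) = 1"
      unfolding nullity_cycle_remove[OF weights_A xs chordless v] using k l by presburger
    finally have "nullity_on A (set xs) = 2" by simp
    moreover have "nullity_on H (set xs) = 0"
    proof (rule ccontr)
      assume "nullity_on H (set xs) \<noteq> 0"
      then obtain z where "z \<in> null_space_on H (set xs)" "z \<noteq> 0"
        by (rule bexE[OF nullity_on_nonzero])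
      then have "cycle_weight H xs = (-1) ^ (2 * k)"
        by (rule cycle_weight_of_null_vector[OF weights_H xs chordless h])
      then show False using * by simp
    qed
    ultimately show "gap (set xs) = 2" by (simp add: gap_def)
  qed
qed

text \<open>Tightness with \<open>d\<close> at least one gives a gap of at least two, and the real
  nullity is at most two; the exact value of \<open>d\<close> on the cycle need not be
  computed.\<close>

lemma tight_cycle_gap:
  assumes xs: "is_cycle E xs" and t: "tight (set xs)"
  shows "gap (set xs) = 2"
proof -
  have v: "cyc_nth xs 0 \<in> set xs" using xs by (intro cyc_nth_in_set) (auto simp: is_cycle_def)
  have "cyclomatic (set xs) \<ge> 1"
    using cyclomatic_remove_cycle_vertex[OF in_cycle_vertices[OF xs order_refl v]]
      cyclomatic_nonneg[of "set xs - {cyc_nth xs 0}"] by linarith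
  moreover have "nullity_on A (set xs) \<le> 2"
    using nullity_cycle_le[OF weights_A xs tight_chordless[OF t xs order_refl]]
      mod_less_divisor[of 2 "length xs - 1"] by linarith
  ultimately show ?thesis using t by (simp add: tight_def gap_def)
qed

section \<open>Covers of the non-cyclic edges\<close>

text \<open>The non-cyclic vertices split into a vertex cover \<open>Y\<close> of the non-cyclic edges and an
  independent set \<open>B\<close>; the surplus of \<open>B\<close> over \<open>Y\<close> is what the non-cyclic part contributes to the
  nullity.\<close>

definition covered :: "'v set \<Rightarrow> bool" where
  "covered X \<longleftrightarrow> (\<exists>Y B. Y \<inter> B = {} \<and> Y \<union> B = X - cycle_vertices X
     \<and> (\<forall>e\<in>ind X. e \<inter> Y = {} \<longrightarrow> e \<subseteq> cycle_vertices X)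
     \<and> card Y \<le> card B
     \<and> nullity_on A X + card Y = nullity_on A (cycle_vertices X) + card B)"

text \<open>The pendant vertex joins \<open>B\<close> and its neighbour joins the cover
  \<open>Y\<close>, so neither the surplus nor the nullity changes. Both are off the cycles because
  \<open>X\<close> is tight.\<close>

lemma covered_pendant:
  assumes X: "tight X" and xy: "pendant_pair X x y" and cov: "covered (X - {x, y})"
  shows "covered X"
proof -
  let ?X = "X - {x, y}" and ?U = "cycle_vertices X"
  note U = tight_pendant(3)[OF X xy]
  obtain Y B where YB: "Y \<inter> B = {}" "Y \<union> B = ?X - ?U" "\<forall>e\<in>ind ?X. e \<inter> Y = {} \<longrightarrow> e \<subseteq> ?U"
    "card Y \<le> card B" "nullity_on A ?X + card Y = nullity_on A ?U + card B"
    using cov unfolding covered_def U by (elim exE conjE) (rule that)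
  have x: "x \<notin> ?U" "y \<notin> ?U" "x \<in> X" "y \<in> X" "x \<noteq> y"
    using pendant_not_on_cycle[OF xy] tight_pendant(4)[OF X xy] xy edge_ne[of x y]
    by (auto simp: pendant_pair_def)
  have nin: "x \<notin> Y" "x \<notin> B" "y \<notin> Y" "y \<notin> B" using YB(2) by blast+
  show ?thesis
    unfolding covered_def
  proof (rule exI[of _ "insert y Y"], rule exI[of _ "insert x B"], intro conjI ballI impI)
    show "insert y Y \<inter> insert x B = {}" using YB(1) nin x by blast
    show "insert y Y \<union> insert x B = X - ?U" using YB(2) x by blast
    show "card (insert y Y) \<le> card (insert x B)" using YB(4) nin by simp
    show "nullity_on A X + card (insert y Y) = nullity_on A ?U + card (insert x B)"
      using YB(5) nin nullity_pendant_pair[OF weights_A xy] by simp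
    fix e assume e: "e \<in> ind X" "e \<inter> insert y Y = {}"
    have "x \<notin> e"
    proof
      assume "x \<in> e"
      have "card e = 2" using ind_edge[OF e(1)] by simp
      then obtain s t where "e = {s, t}" by (meson card_2_iff)
      then obtain u where u: "e = {x, u}" using \<open>x \<in> e\<close> by auto
      then have "u = y" using e(1) xy by (auto simp: pendant_pair_def)
      then show False using e(2) u by blast
    qed
    then have "e \<in> ind ?X" using e by (auto simp: induced_edges_def)
    then show "e \<subseteq> ?U" using YB(3) e(2) by blast
  qed
qed

lemma cycle_vertices_isolated:
  assumes "\<And>u. u \<in> X \<Longrightarrow> {v, u} \<notin> E"
  shows "v \<notin> cycle_vertices X" "cycle_vertices (X - {v}) = cycle_vertices X"
proof -
  show v: "v \<notin> cycle_vertices X"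
  proof
    assume "v \<in> cycle_vertices X"
    then obtain xs where xs: "is_cycle E xs" "set xs \<subseteq> X" "v \<in> set xs"
      by (auto simp: cycle_vertices_def)
    obtain p q where "p \<in> set xs - {v}" "{v, p} \<in> E" "q \<in> set xs - {v}"
      by (rule cycle_neighbours[OF xs]) (rule that)
    then show False using assms[of p] xs(2) by blast
  qed
  have "set xs \<subseteq> X - {v}" if "is_cycle E xs" "set xs \<subseteq> X" for xs
    using that v by (auto simp: cycle_vertices_def)
  then show "cycle_vertices (X - {v}) = cycle_vertices X" unfolding cycle_vertices_def by blast
qed

text \<open>The isolated vertex joins \<open>B\<close>, raising the surplus and the nullity by one
  each.\<close>

lemma covered_isolated:
  assumes v: "v \<in> X" "\<And>u. u \<in> X \<Longrightarrow> {v, u} \<notin> E" and cov: "covered (X - {v})"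
  shows "covered X"
proof -
  let ?X = "X - {v}" and ?U = "cycle_vertices X"
  have U: "v \<notin> ?U" "cycle_vertices ?X = ?U"
    using cycle_vertices_isolated[of X v] v(2) by simp_all
  obtain Y B where YB: "Y \<inter> B = {}" "Y \<union> B = ?X - ?U" "\<forall>e\<in>ind ?X. e \<inter> Y = {} \<longrightarrow> e \<subseteq> ?U"
    "card Y \<le> card B" "nullity_on A ?X + card Y = nullity_on A ?U + card B"
    using cov unfolding covered_def U(2) by (elim exE conjE) (rule that)
  have nin: "v \<notin> Y" "v \<notin> B" using YB(2) by blast+
  show ?thesis
    unfolding covered_def
  proof (rule exI[of _ Y], rule exI[of _ "insert v B"], intro conjI ballI impI)
    show "Y \<inter> insert v B = {}" using YB(1) nin by blast
    show "Y \<union> insert v B = X - ?U" using YB(2) v U by blast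
    show "card Y \<le> card (insert v B)" using YB(4) nin by simp
    show "nullity_on A X + card Y = nullity_on A ?U + card (insert v B)"
      using YB(5) nin nullity_isolated[OF weights_A v] by simp
    fix e assume e: "e \<in> ind X" "e \<inter> Y = {}"
    have "v \<notin> e"
    proof
      assume "v \<in> e"
      have "card e = 2" using ind_edge[OF e(1)] by simp
      then obtain s t where "e = {s, t}" by (meson card_2_iff)
      then obtain u where u: "e = {v, u}" using \<open>v \<in> e\<close> by auto
      then show False using e(1) v(2)[of u] by simp
    qed
    then have "e \<in> ind ?X" using e by (auto simp: induced_edges_def)
    then show "e \<subseteq> ?U" using YB(3) e(2) by blast
  qed
qed

text \<open>If all vertices of \<open>B\<close> but one had degree at least two, the edges at \<open>B\<close> would be too
  numerous to avoid a cycle.\<close>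

lemma covered_surplus_degree:
  assumes YB: "Y \<inter> B = {}" "Y \<union> B = X - cycle_vertices X"
    "\<forall>e\<in>ind X. e \<inter> Y = {} \<longrightarrow> e \<subseteq> cycle_vertices X"
    and surplus: "card Y < card B"
    and deg: "\<And>b. b \<in> B \<Longrightarrow> b \<noteq> r \<Longrightarrow> 2 \<le> card {u\<in>X. {b, u} \<in> E}"
    and deg1: "r \<in> B \<Longrightarrow> 1 \<le> card {u\<in>X. {r, u} \<in> E}"
  shows False
proof -
  define F where "F = {e\<in>ind X. e \<inter> B \<noteq> {}}"
  have BX: "B \<subseteq> X" using YB(2) by blast
  \<comment> \<open>An edge of \<open>X\<close> missing \<open>Y\<close> lies within the cycle
    vertices, where \<open>B\<close> has no members.\<close>
  have meetY: "e \<inter> Y \<noteq> {}" if "e \<in> F" for e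
    using that YB unfolding F_def by blast
  have F: "card (e \<inter> B) \<le> 1 \<and> e \<subseteq> Y \<union> B \<and> card e = 2" if e: "e \<in> F" for e
  proof -
    have c: "card e = 2" using e ind_edge[of e X] by (simp add: F_def)
    obtain y b where yb: "y \<in> e" "y \<in> Y" "b \<in> e" "b \<in> B" using meetY[OF e] e by (auto simp: F_def)
    obtain s t where st: "e = {s, t}" using c by (meson card_2_iff)
    then have "e = {y, b}" using yb YB(1) by auto
    then have "e \<inter> B = {b}" "e \<subseteq> Y \<union> B" using yb YB(1) by auto
    then show ?thesis using c by simp
  qed
  \<comment> \<open>The extra 1 makes up for the possible degree one of \<open>r\<close>.\<close>
  have "2 * card B \<le> (\<Sum>b\<in>B. card {u\<in>X. {b, u} \<in> E}) + 1"
  proof (cases "r \<in> B")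
    case True
    have "2 * card (B - {r}) = (\<Sum>b\<in>B - {r}. 2)" by simp
    also have "\<dots> \<le> (\<Sum>b\<in>B - {r}. card {u\<in>X. {b, u} \<in> E})" by (rule sum_mono) (use deg in auto)
    finally have "2 * card (B - {r}) \<le> (\<Sum>b\<in>B - {r}. card {u\<in>X. {b, u} \<in> E})" .
    moreover have "(\<Sum>b\<in>B. card {u\<in>X. {b, u} \<in> E}) =
        card {u\<in>X. {r, u} \<in> E} + (\<Sum>b\<in>B - {r}. card {u\<in>X. {b, u} \<in> E})"
      using True by (intro sum.remove) auto
    moreover have "card B = Suc (card (B - {r}))" using True by (intro card.remove) auto
    ultimately show ?thesis using deg1[OF True] by linarith
  next
    case False
    have "2 * card B = (\<Sum>b\<in>B. 2)" by simp
    also have "\<dots> \<le> (\<Sum>b\<in>B. card {u\<in>X. {b, u} \<in> E})" by (rule sum_mono) (use deg False in auto)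
    finally show ?thesis by simp
  qed
  also have "(\<Sum>b\<in>B. card {u\<in>X. {b, u} \<in> E}) = (\<Sum>e\<in>ind X. card (e \<inter> B))"
    by (rule sum_degrees[OF BX])
  also have "\<dots> = (\<Sum>e\<in>F. card (e \<inter> B))"
    by (rule sum.mono_neutral_right) (auto simp: F_def)
  also have "\<dots> \<le> (\<Sum>e\<in>F. 1)" by (rule sum_mono) (use F in blast)
  finally have "2 * card B \<le> card F + 1" by simp
  moreover have "card (Y \<union> B) = card Y + card B" using YB(1) by (simp add: card_Un_disjoint)
  \<comment> \<open>The surplus gives \<open>card Y + card B \<le> 2 * card B - 1\<close>, which
    compensates exactly for the one missing degree.\<close>
  ultimately have "card (Y \<union> B) \<le> card F" using surplus by linarith
  moreover have "Y \<union> B \<noteq> {}" using surplus by auto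
  ultimately obtain xs where xs: "is_cycle F xs"
    using cycle_exists[of "Y \<union> B" F] F by auto
  have "is_cycle (ind X) xs" using xs by (rule is_cycle_mono) (auto simp: F_def)
  then have cyc: "is_cycle E xs" "set xs \<subseteq> X" by (simp_all add: is_cycle_induced_iff)
  have ne: "xs \<noteq> []" using xs by (auto simp: is_cycle_def)
  then have "{cyc_nth xs 0, cyc_nth xs (Suc 0)} \<in> cycle_edges xs" using cycle_edges_eq by blast
  then have "{cyc_nth xs 0, cyc_nth xs (Suc 0)} \<in> F" using xs by (auto simp: is_cycle_def)
  \<comment> \<open>A cycle formed by edges of \<open>F\<close> would run through vertices that were
    chosen off all cycles.\<close>
  then have "cyc_nth xs 0 \<in> Y \<union> B" using F by blast
  moreover have "cyc_nth xs 0 \<in> cycle_vertices X" using in_cycle_vertices[OF cyc] ne by simp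
  ultimately show False using YB(2) by blast
qed

text \<open>The assumptions on proper subsets \<open>Z\<close> are the induction hypotheses of
  \<open>tight_structure\<close>; the other two restrict to the case in which neither a pendant nor
  an isolated vertex can be removed.\<close>

lemma no_bridge:
  assumes X: "tight X" and free: "\<not> (\<exists>x y. pendant_pair X x y)"
    and non_isolated: "\<And>v. v \<in> X \<Longrightarrow> \<exists>u\<in>X. {v, u} \<in> E"
    and IH_cycle: "\<And>Z xs. Z \<subset> X \<Longrightarrow> tight Z \<Longrightarrow> is_cycle E xs \<Longrightarrow> set xs \<subseteq> Z \<Longrightarrow> tight (set xs)"
    and IH_cov: "\<And>Z. Z \<subset> X \<Longrightarrow> tight Z \<Longrightarrow> covered Z"
  shows "\<not> bridge X a b"
proof
  assume br: "bridge X a b"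
  then have rb: "bridge X b a" using bridge_sym by blast
  obtain xs v w where xs: "is_cycle E xs" "set xs \<subseteq> branch X b a" and v: "v \<in> set xs"
    and w: "w \<in> X - set xs" "{v, w} \<in> E"
    and leaf: "\<forall>s\<in>set xs. \<forall>c\<in>X - set xs. {s, c} \<in> E \<longrightarrow> s = v \<and> c = w"
    using leaf_cycle_exists[OF X free rb] by blast
  obtain ys where ys: "is_cycle E ys" "set ys \<subseteq> branch X a b"
    using leaf_cycle_exists[OF X free br] by blast
  have xsX: "set xs \<subseteq> X" and ysX: "set ys \<subseteq> X"
    using xs ys branch_subset[OF br] branch_subset[OF rb] by blast+
  have chordless: "ind (set xs) \<subseteq> cycle_edges xs" by (rule tight_chordless[OF X xs(1) xsX])
  \<comment> \<open>Tightness of \<open>xs\<close> is not yet known in \<open>X\<close> itself.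
    Deleting a vertex \<open>t\<close> of the cycle \<open>ys\<close> beyond the bridge leaves a
    proper tight subgraph containing \<open>xs\<close>, to which the induction hypothesis
    applies.\<close>
  have even_length: "(length xs - 1) mod 2 = 1"
  proof -
    obtain t where t: "t \<in> set ys" using ys(1) by (cases ys) (auto simp: is_cycle_def)
    have "t \<notin> set xs" using t xs ys branches_disjoint[OF br] by blast
    moreover have "tight (X - {t})" by (rule tight_remove(1)[OF X in_cycle_vertices[OF ys(1) ysX t]])
    moreover have "X - {t} \<subset> X" using t ysX by blast
    ultimately have "tight (set xs)" using IH_cycle[of "X - {t}" xs] xs xsX by blast
    then have "4 dvd length xs"
      using tight_cycle_gap[OF xs(1)] gap_cycle_eq_2_iff[OF xs(1) chordless] by blast
    moreover have "length xs \<ge> 3" using xs(1) by (simp add: is_cycle_def)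
    ultimately show ?thesis by presburger
  qed
  obtain p q where pq: "p \<noteq> q" "p \<in> set xs - {v}" "q \<in> set xs - {v}" "{v, p} \<in> E" "{v, q} \<in> E"
    "\<And>u. {v, u} \<in> cycle_edges xs \<longleftrightarrow> u = p \<or> u = q"
    by (rule cycle_neighbours[OF xs(1) xsX v]) (rule that)
  have p: "p \<in> set xs" using pq by blast
  obtain r r' where rr: "\<And>u. {p, u} \<in> cycle_edges xs \<longleftrightarrow> u = r \<or> u = r'"
    by (rule cycle_neighbours[OF xs(1) xsX p]) (rule that)
  define K where "K = X - set xs"
  note rem_v = tight_remove[OF X in_cycle_vertices[OF xs(1) xsX v]]
  note rem_p = tight_remove[OF X in_cycle_vertices[OF xs(1) xsX p]]
  have split: "X - {v} = K \<union> (set xs - {v})" using w v xsX by (auto simp: K_def)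
  have disj: "K \<inter> (set xs - {v}) = {}" by (auto simp: K_def)
  have sep: "{c, s} \<notin> E" if "c \<in> K" "s \<in> set xs - {v}" for c s
    using leaf that by (auto simp: K_def insert_commute)
  have nullA: "nullity_on A (X - {v}) = nullity_on A K + 1"
    using nullity_union[OF weights_A disj] sep
      nullity_cycle_remove[OF weights_A xs(1) chordless v] even_length split by simp
  have "nullity_on H (X - {v}) = nullity_on H K + 1"
    using nullity_union[OF weights_H disj] sep
      nullity_cycle_remove[OF weights_H xs(1) chordless v] even_length split by simp
  \<comment> \<open>The path contributes one to both nullities, so it cancels in the gap.\<close>
  then have "gap K = gap (X - {v})" using nullA by (simp add: gap_def)
  then have tK: "tight K"
    using rem_v(1) gap_le[of K] cyclomatic_mono[of K "X - {v}"] split by (auto simp: tight_def)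
  \<comment> \<open>A cycle meeting \<open>xs\<close> has the same vertices as \<open>xs\<close>, so
    deleting \<open>p\<close> destroys exactly this one.\<close>
  have UK: "cycle_vertices (X - {p}) = cycle_vertices K"
  proof
    show "cycle_vertices K \<subseteq> cycle_vertices (X - {p})"
      by (rule cycle_vertices_mono) (use p in \<open>auto simp: K_def\<close>)
    have "set zs \<subseteq> K" if zs: "is_cycle E zs" "set zs \<subseteq> X - {p}" for zs
    proof -
      have "set zs \<inter> set xs = {}"
      proof (rule ccontr)
        assume meet: "set zs \<inter> set xs \<noteq> {}"
        have "set zs \<subseteq> X" using zs by blast
        then have "set zs = set xs" using tight_cycle_unique(1)[OF X zs(1) _ xs(1) xsX meet] by blast
        then show False using zs p by blast
      qed
      then show ?thesis using zs by (auto simp: K_def)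
    qed
    then show "cycle_vertices (X - {p}) \<subseteq> cycle_vertices K" unfolding cycle_vertices_def by blast
  qed
  have "K \<subset> X" using v xsX by (auto simp: K_def)
  then have "covered K" using IH_cov tK by blast
  then have geK: "nullity_on A (cycle_vertices K) \<le> nullity_on A K" unfolding covered_def by auto
  have "X - {p} \<subset> X" using p xsX by blast
  then have "covered (X - {p})" using IH_cov rem_p(1) by blast
  then obtain Y B where YB: "Y \<inter> B = {}" "Y \<union> B = X - {p} - cycle_vertices (X - {p})"
    "\<forall>e\<in>ind (X - {p}). e \<inter> Y = {} \<longrightarrow> e \<subseteq> cycle_vertices (X - {p})"
    "nullity_on A (X - {p}) + card Y = nullity_on A (cycle_vertices (X - {p})) + card B"
    unfolding covered_def by (elim exE conjE) (rule that)
  \<comment> \<open>The nullities of \<open>X - {p}\<close> and \<open>X - {v}\<close> are both one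
    less than that of \<open>X\<close>, hence equal to \<open>nullity_on A K + 1\<close>, which
    exceeds the nullity on the cycle vertices.\<close>
  have surplus: "card Y < card B"
    using YB(4) geK nullA rem_v(3) rem_p(3) unfolding UK by linarith
  have deg: "2 \<le> card {u\<in>X. {b, u} \<in> E}" if "b \<in> X" for b
  proof (rule ccontr)
    assume "\<not> ?thesis"
    then have "card {u\<in>X. {b, u} \<in> E} \<le> 1" by simp
    moreover obtain u where "u \<in> X" "{b, u} \<in> E" using non_isolated[OF \<open>b \<in> X\<close>] by blast
    ultimately have "pendant_pair X b u" using pendant_pair_if_degree_one \<open>b \<in> X\<close> by blast
    then show False using free by blast
  qed
  have nbr_p: "b = r \<or> b = r'" if "b \<in> X" "{b, p} \<in> E" for b
  proof -
    have "{p, b} \<in> E" using that(2) by (simp add: insert_commute)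
    then have "b \<in> set xs" using leaf p that(1) pq(2) by blast
    then have "{p, b} \<in> ind (set xs)" using that p by (simp add: insert_commute)
    then show ?thesis using chordless rr by blast
  qed
  have "{p, v} \<in> cycle_edges xs" using pq(6)[of p] by (simp add: insert_commute)
  then have v_or: "v = r \<or> v = r'" using rr by blast
  \<comment> \<open>The other cycle neighbour of \<open>p\<close>. Besides \<open>v\<close>, only
    this vertex loses an edge when \<open>p\<close> is deleted.\<close>
  define c where "c = (if v = r then r' else r)"
  \<comment> \<open>The vertex \<open>v\<close> keeps its other cycle neighbour \<open>q\<close> and
    the outside neighbour \<open>w\<close>.\<close>
  have big: "2 \<le> card {u\<in>X - {p}. {b, u} \<in> E}" if b: "b \<in> B" "b \<noteq> c" for b
  proof (cases "b = v")
    case True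
    have "{q, w} \<subseteq> {u\<in>X - {p}. {b, u} \<in> E}" using True pq w p xsX by auto
    moreover have "card {q, w} = 2" using pq w by (auto simp: card_2_iff)
    ultimately show ?thesis by (metis card_mono finite)
  next
    case False
    have "b \<in> X" using b YB(2) by blast
    moreover have "{b, p} \<notin> E"
      using nbr_p[OF \<open>b \<in> X\<close>] v_or False b(2) by (auto simp: c_def split: if_splits)
    then have "{u\<in>X - {p}. {b, u} \<in> E} = {u\<in>X. {b, u} \<in> E}" by auto
    ultimately show ?thesis using deg by simp
  qed
  have small: "1 \<le> card {u\<in>X - {p}. {c, u} \<in> E}" if "c \<in> B"
  proof -
    have "c \<in> X" using that YB(2) by blast
    have "{u\<in>X. {c, u} \<in> E} \<subseteq> insert p {u\<in>X - {p}. {c, u} \<in> E}" by auto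
    then have "card {u\<in>X. {c, u} \<in> E} \<le> card (insert p {u\<in>X - {p}. {c, u} \<in> E})"
      by (rule card_mono[rotated]) simp
    then show ?thesis using deg[OF \<open>c \<in> X\<close>] by simp
  qed
  show False using covered_surplus_degree[OF YB(1,2,3) surplus, of c] big small by blast
qed

text \<open>The three claims are proved together because excluding a bridge in \<open>X\<close> uses
  the other two for proper subgraphs. When neither a pendant pair nor an isolated vertex is left,
  the absence of bridges puts every vertex on a cycle, and the other claims follow easily.\<close>

lemma tight_structure:
  assumes "tight X"
  shows "(\<forall>xs. is_cycle E xs \<longrightarrow> set xs \<subseteq> X \<longrightarrow> tight (set xs)) \<and> covered X
    \<and> (\<not> (\<exists>x y. pendant_pair X x y) \<longrightarrow> (\<forall>a b. \<not> bridge X a b))"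
  using assms
proof (induction "card X" arbitrary: X rule: less_induct)
  case less
  have IH: "(\<forall>xs. is_cycle E xs \<longrightarrow> set xs \<subseteq> Z \<longrightarrow> tight (set xs)) \<and> covered Z
      \<and> (\<not> (\<exists>x y. pendant_pair Z x y) \<longrightarrow> (\<forall>a b. \<not> bridge Z a b))" if "Z \<subset> X" "tight Z" for Z
    by (rule less.hyps) (use that in \<open>auto intro: psubset_card_mono\<close>)
  have IH_cycle: "tight (set xs)" if "Z \<subset> X" "tight Z" "is_cycle E xs" "set xs \<subseteq> Z" for Z xs
    using IH[OF that(1,2)] that(3,4) by blast
  have IH_cov: "covered Z" if "Z \<subset> X" "tight Z" for Z using IH[OF that] by blast
  consider x y where "pendant_pair X x y"
    | v where "\<not> (\<exists>x y. pendant_pair X x y)" "v \<in> X" "\<forall>u\<in>X. {v, u} \<notin> E"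
    | "\<not> (\<exists>x y. pendant_pair X x y)" "\<forall>v\<in>X. \<exists>u\<in>X. {v, u} \<in> E"
    by blast
  then show ?case
  proof cases
    case (1 x y)
    have "x \<in> X" using 1 by (simp add: pendant_pair_def)
    then have sub: "X - {x, y} \<subset> X" by blast
    note t = tight_pendant[OF less.prems 1]
    have "tight (set xs)" if "is_cycle E xs" "set xs \<subseteq> X" for xs
    proof (rule IH_cycle[OF sub t(1) that(1)])
      show "set xs \<subseteq> X - {x, y}"
        using in_cycle_vertices[OF that] cycle_vertices_subset[of "X - {x, y}"] t(3) by blast
    qed
    then show ?thesis using 1 covered_pendant[OF less.prems 1 IH_cov[OF sub t(1)]] by blast
  next
    case (2 v)
    have iso: "\<And>u. u \<in> X \<Longrightarrow> {v, u} \<notin> E" using 2 by blast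
    have sub: "X - {v} \<subset> X" using 2 by blast
    have t: "tight (X - {v})" using tight_isolated[OF less.prems 2(2)] iso by simp
    have U: "cycle_vertices (X - {v}) = cycle_vertices X" using cycle_vertices_isolated(2)[of X v] iso by simp
    have cyc: "set xs \<subseteq> X - {v}" if "is_cycle E xs" "set xs \<subseteq> X" for xs
      using in_cycle_vertices[OF that] cycle_vertices_subset[of "X - {v}"] U by blast
    have "tight (set xs)" if "is_cycle E xs" "set xs \<subseteq> X" for xs
      by (rule IH_cycle[OF sub t that(1) cyc[OF that]])
    moreover have "covered X" using covered_isolated[OF 2(2) _ IH_cov[OF sub t]] iso by simp
    moreover have "\<not> bridge X a b" for a b
    proof
      assume br: "bridge X a b"
      then have "a \<noteq> v" "b \<noteq> v" using iso by (auto simp: bridge_def insert_commute)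
      then have "bridge (X - {v}) a b" using br by (auto simp: bridge_def)
      moreover have "\<not> pendant_pair (X - {v}) x y" for x y
      proof
        assume xy: "pendant_pair (X - {v}) x y"
        then have "{x, v} \<notin> E" using iso[of x] by (simp add: pendant_pair_def insert_commute)
        then have "pendant_pair X x y" using xy unfolding pendant_pair_def by blast
        then show False using 2(1) by blast
      qed
      ultimately show False using IH[OF sub t] by blast
    qed
    ultimately show ?thesis by blast
  next
    case 3
    have nb: "\<not> bridge X a b" for a b
      by (rule no_bridge[OF less.prems 3(1)]) (use 3(2) IH_cycle IH_cov in blast)+
    have U: "cycle_vertices X = X"
    proof
      show "X \<subseteq> cycle_vertices X"
      proof
        fix v assume v: "v \<in> X"
        then obtain u where "u \<in> X" "{v, u} \<in> E" using 3(2) by blast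
        then obtain xs where "is_cycle E xs" "set xs \<subseteq> X" "{v, u} \<in> cycle_edges xs"
          using nb[of v u] v by (auto simp: bridge_def)
        then show "v \<in> cycle_vertices X" using vertex_on_cycle[of v "{v, u}" xs X] by blast
      qed
    qed (rule cycle_vertices_subset)
    have "tight (set xs)" if xs: "is_cycle E xs" "set xs \<subseteq> X" for xs
    proof (cases "set xs = X")
      case True
      then show ?thesis using less.prems by simp
    next
      \<comment> \<open>Any vertex \<open>u\<close> outside \<open>xs\<close> lies on some cycle, so
        it can be deleted without losing tightness.\<close>
      case False
      then obtain u where u: "u \<in> X" "u \<notin> set xs" using xs by blast
      then have "tight (X - {u})" using tight_remove(1)[OF less.prems, of u] U by simp
      moreover have "X - {u} \<subset> X" "set xs \<subseteq> X - {u}" using u xs by blast+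
      ultimately show ?thesis using IH_cycle xs(1) by blast
    qed
    moreover have "covered X"
      unfolding covered_def
    \<comment> \<open>There are no non-cyclic vertices, so both parts are empty.\<close>
    proof (rule exI[of _ "{}"], rule exI[of _ "{}"], intro conjI ballI impI)
      fix e assume "e \<in> ind X"
      then show "e \<subseteq> cycle_vertices X" using U by (auto simp: induced_edges_def)
    qed (use U in auto)
    ultimately show ?thesis using nb by blast
  qed
qed

section \<open>Delta-transformations and crucial subgraphs\<close>

lemma pendant_vertex_iff: "pendant_vertex X (ind X) x \<longleftrightarrow> (\<exists>y. pendant_pair X x y)"
proof
  assume "pendant_vertex X (ind X) x"
  then have x: "x \<in> X" and "card {y. {x, y} \<in> ind X} = 1" by (auto simp: pendant_vertex_def)
  then obtain y where y: "{u. {x, u} \<in> ind X} = {y}" by (meson card_1_singletonE)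
  then have mem: "{x, u} \<in> ind X \<longleftrightarrow> u = y" for u by blast
  then have "pendant_pair X x y" using x mem[of y] unfolding pendant_pair_def by auto
  then show "\<exists>y. pendant_pair X x y" by blast
next
  assume "\<exists>y. pendant_pair X x y"
  then obtain y where y: "pendant_pair X x y" by blast
  then have "{u. {x, u} \<in> ind X} = {y}" by (auto simp: pendant_pair_def)
  then show "pendant_vertex X (ind X) x" using y by (simp add: pendant_vertex_def pendant_pair_def)
qed

lemma delta_transformation_iff:
  "delta_transformation E X W \<longleftrightarrow> (\<exists>x y. pendant_pair X x y \<and> W = X - {x, y})"
proof
  assume "delta_transformation E X W"
  then obtain x y where xy: "pendant_vertex X (ind X) x" "{x, y} \<in> ind X" "W = X - {x, y}"
    by (auto simp: delta_transformation.simps)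
  then obtain y' where y': "pendant_pair X x y'" using pendant_vertex_iff by blast
  then have "y = y'" using xy(2) by (auto simp: pendant_pair_def)
  then show "\<exists>x y. pendant_pair X x y \<and> W = X - {x, y}" using y' xy(3) by blast
next
  assume "\<exists>x y. pendant_pair X x y \<and> W = X - {x, y}"
  then obtain x y where xy: "pendant_pair X x y" "W = X - {x, y}" by blast
  then have "pendant_vertex X (ind X) x" "{x, y} \<in> ind X"
    using pendant_vertex_iff by (auto simp: pendant_pair_def)
  then show "delta_transformation E X W" unfolding xy(2) by (rule delta_transformation.intros)
qed

lemma gap_delta:
  assumes "(delta_transformation E)\<^sup>*\<^sup>* X W" shows "gap X = gap W"
  using assms
proof (induction rule: rtranclp_induct)
  case (step Y Z)
  then show ?case using gap_pendant by (auto simp: delta_transformation_iff)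
qed simp

lemma tight_crucial_exists:
  assumes "tight X"
  shows "\<exists>W. crucial_subgraph X E W \<and> tight W \<and> cyclomatic W = cyclomatic X"
  using assms
proof (induction "card X" arbitrary: X rule: less_induct)
  case less
  show ?case
  proof (cases "\<exists>x y. pendant_pair X x y")
    case False
    then have "crucial_subgraph X E X" by (simp add: crucial_subgraph_def pendant_vertex_iff)
    then show ?thesis using less.prems by blast
  next
    case True
    then obtain x y where xy: "pendant_pair X x y" by blast
    then have "x \<in> X" by (simp add: pendant_pair_def)
    then have "card (X - {x, y}) < card X" by (intro psubset_card_mono) auto
    then obtain W where W: "crucial_subgraph (X - {x, y}) E W" "tight W"
        "cyclomatic W = cyclomatic (X - {x, y})"
      using less.hyps[of "X - {x, y}"] tight_pendant(1)[OF less.prems xy] by blast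
    have "delta_transformation E X (X - {x, y})" using xy delta_transformation_iff by blast
    then have "crucial_subgraph X E W"
      using W(1) by (auto simp: crucial_subgraph_def intro: converse_rtranclp_into_rtranclp)
    then show ?thesis using W tight_pendant(2)[OF less.prems xy] by auto
  qed
qed

text \<open>All edges lie on the given cycles, so there are none between different cycles or at
  \<open>I\<close>; the gap is additive over the parts and an edgeless part has gap zero. For the
  same reason the cycles have no chords.\<close>

lemma gap_disjoint_cycles:
  assumes C: "finite C" "\<forall>xs\<in>C. is_cycle (ind W) xs"
    "pairwise (\<lambda>xs ys. disjnt (set xs) (set ys)) C"
    and W: "disjnt (\<Union>(set ` C)) I" "W = \<Union>(set ` C) \<union> I"
    and edges: "ind W = \<Union>(cycle_edges ` C)"
  shows "gap W = (\<Sum>xs\<in>C. gap (set xs))" "\<forall>xs\<in>C. ind (set xs) \<subseteq> cycle_edges xs"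
proof -
  have disj: "set xs \<inter> set ys = {}" if "xs \<in> C" "ys \<in> C" "xs \<noteq> ys" for xs ys
    using C(3) that by (auto simp: pairwise_def disjnt_def)
  have on: "\<exists>xs\<in>C. u \<in> set xs \<and> v \<in> set xs \<and> {u, v} \<in> cycle_edges xs"
    if uv: "u \<in> W" "v \<in> W" "{u, v} \<in> E" for u v
  proof -
    have "{u, v} \<in> ind W" using uv by simp
    then obtain xs where xs: "xs \<in> C" "{u, v} \<in> cycle_edges xs" using edges by blast
    then show ?thesis using cycle_edges_subset[OF xs(2)] by blast
  qed
  show "\<forall>xs\<in>C. ind (set xs) \<subseteq> cycle_edges xs"
  proof (intro ballI subsetI)
    fix xs e assume xs: "xs \<in> C" and e: "e \<in> ind (set xs)"
    have "card e = 2" using ind_edge[OF e] by simp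
    then obtain u v where uv: "e = {u, v}" by (meson card_2_iff)
    then have uv': "u \<in> set xs" "v \<in> set xs" "{u, v} \<in> E" using e by auto
    moreover have "set xs \<subseteq> W" using xs W by blast
    ultimately obtain ys where ys: "ys \<in> C" "u \<in> set ys" "{u, v} \<in> cycle_edges ys"
      using on[of u v] by blast
    then have "ys = xs" using disj[OF ys(1) xs] uv' by blast
    then show "e \<in> cycle_edges xs" using ys uv by simp
  qed
  have sum: "gap (\<Union>(set ` D)) = (\<Sum>xs\<in>D. gap (set xs))" if "D \<subseteq> C" for D
  proof -
    have "finite D" using C(1) that by (rule rev_finite_subset)
    then show ?thesis using that
    proof (induction D rule: finite_induct)
      case (insert xs D)
      have d: "set xs \<inter> \<Union>(set ` D) = {}" using disj insert by blast
      have "gap (set xs \<union> \<Union>(set ` D)) = gap (set xs) + gap (\<Union>(set ` D))"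
      proof (rule gap_union[OF d], rule notI)
        fix u v assume u: "u \<in> set xs" and v: "v \<in> \<Union>(set ` D)" and uv: "{u, v} \<in> E"
        have "u \<in> W" "v \<in> W" using u v insert.prems W(2) by blast+
        then obtain ys where ys: "ys \<in> C" "u \<in> set ys" "v \<in> set ys" using on uv by blast
        then have "ys = xs" using disj[OF ys(1), of xs] u insert.prems by blast
        then show False using ys(3) v d by blast
      qed
      then show ?case using insert by simp
    qed simp
  qed
  have noI: "{u, v} \<notin> E" if uv: "u \<in> W" "v \<in> I" for u v
  proof
    assume "{u, v} \<in> E"
    moreover have "v \<in> W" using uv(2) W(2) by blast
    ultimately obtain xs where "xs \<in> C" "v \<in> set xs" using on[OF uv(1)] by blast
    then show False using uv(2) W(1) by (auto simp: disjnt_def)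
  qed
  have "ind I = {}"
  proof (rule ccontr)
    assume "ind I \<noteq> {}"
    then obtain e where e: "e \<in> ind I" by blast
    have "card e = 2" using ind_edge[OF e] by simp
    then obtain u v where uv: "e = {u, v}" by (meson card_2_iff)
    then show False using e noI[of u v] W(2) by auto
  qed
  then have "gap I = 0" by (rule gap_edgeless)
  moreover have "gap W = gap (\<Union>(set ` C)) + gap I"
    unfolding W(2)
  proof (rule gap_union)
    show "\<Union>(set ` C) \<inter> I = {}" using W(1) by (simp add: disjnt_def)
    show "\<And>u v. u \<in> \<Union>(set ` C) \<Longrightarrow> v \<in> I \<Longrightarrow> {u, v} \<notin> E" using noI W(2) by blast
  qed
  ultimately show "gap W = (\<Sum>xs\<in>C. gap (set xs))" using sum[OF order_refl] by simp
qed

lemma tight_pendant_free_disjoint_cycles: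
  assumes t: "tight W" and free: "\<not> (\<exists>x y. pendant_pair W x y)"
  shows "disjoint_cycles_and_isolated W (ind W) (cyclomatic W)"
proof -
  define S where "S = {set xs | xs. is_cycle E xs \<and> set xs \<subseteq> W}"
  \<comment> \<open>Rotations and reversals present the same cycle, so one traversal is chosen for
    each vertex set.\<close>
  define rep where "rep T = (SOME xs. is_cycle E xs \<and> set xs = T)" for T
  have rep: "is_cycle E (rep T) \<and> set (rep T) = T" if "T \<in> S" for T
    unfolding rep_def by (rule someI_ex) (use that in \<open>auto simp: S_def\<close>)
  have SW: "T \<subseteq> W" if "T \<in> S" for T using that by (auto simp: S_def)
  define C where "C = rep ` S"
  have Cprops: "is_cycle E xs" "set xs \<subseteq> W" "xs = rep (set xs)" if "xs \<in> C" for xs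
    using that rep SW by (auto simp: C_def)
  have Cfin: "finite C" by (simp add: C_def)
  have Ccyc: "\<forall>xs\<in>C. is_cycle (ind W) xs" using Cprops by (simp add: is_cycle_induced_iff)
  have Cdisj: "pairwise (\<lambda>xs ys. disjnt (set xs) (set ys)) C"
  proof (rule pairwiseI)
    fix xs ys assume c: "xs \<in> C" "ys \<in> C" "xs \<noteq> ys"
    show "disjnt (set xs) (set ys)"
    proof (rule ccontr)
      assume "\<not> ?thesis"
      then have "set xs = set ys"
        using tight_cycle_unique(1)[OF t Cprops(1,2)[OF c(1)] Cprops(1,2)[OF c(2)]]
        by (simp add: disjnt_def)
      then have "xs = ys" using Cprops(3)[OF c(1)] Cprops(3)[OF c(2)] by simp
      then show False using c by simp
    qed
  qed
  have edges: "ind W = \<Union>(cycle_edges ` C)"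
  proof (intro equalityI subsetI)
    fix e assume e: "e \<in> ind W"
    have "card e = 2" using ind_edge[OF e] by simp
    then obtain a b where ab: "e = {a, b}" by (meson card_2_iff)
    have "\<not> bridge W a b" using tight_structure[OF t] free by blast
    then obtain xs where xs: "is_cycle E xs" "set xs \<subseteq> W" "e \<in> cycle_edges xs"
      using e ab by (auto simp: bridge_def)
    then have S: "set xs \<in> S" by (auto simp: S_def)
    then have r: "rep (set xs) \<in> C" "set (rep (set xs)) = set xs" using rep by (auto simp: C_def)
    have "set xs \<noteq> {}" using xs(1) by (auto simp: is_cycle_def)
    then have "cycle_edges xs = cycle_edges (rep (set xs))"
      using tight_cycle_unique(2)[OF t xs(1,2) Cprops(1,2)[OF r(1)]] r(2) by simp
    then show "e \<in> \<Union>(cycle_edges ` C)" using xs(3) r(1) by blast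
  next
    fix e assume "e \<in> \<Union>(cycle_edges ` C)"
    then show "e \<in> ind W" using Ccyc unfolding is_cycle_def by blast
  qed
  define I where "I = W - \<Union>(set ` C)"
  have W: "disjnt (\<Union>(set ` C)) I" "W = \<Union>(set ` C) \<union> I"
    using Cprops(2) by (auto simp: I_def disjnt_def)
  \<comment> \<open>The number of cycles is read off from the gap: each cycle contributes two, and
    tightness says that the total is twice \<open>d\<close>.\<close>
  have "gap (set xs) = 2" if "xs \<in> C" for xs
    using tight_structure[OF t] Cprops(1,2)[OF that] tight_cycle_gap by blast
  then have "gap W = 2 * int (card C)"
    unfolding gap_disjoint_cycles(1)[OF Cfin Ccyc Cdisj W edges] by simp
  then have "int (card C) = cyclomatic W" using t by (simp add: tight_def)
  then show ?thesis
    unfolding disjoint_cycles_and_isolated_def using Cfin Ccyc Cdisj W edges by blast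
qed

text \<open>For the converse, the gap survives every delta-transformation and is the sum over the
  cycles of the crucial subgraph. Each contributes two by the weight condition, and their number is
  prescribed to be the cyclomatic number of the whole graph.\<close>

lemma tight_iff:
  "tight UNIV \<longleftrightarrow> cycles_vertex_disjoint E
    \<and> (\<forall>xs. is_cycle E xs \<longrightarrow> 4 dvd length xs \<and> cycle_weight H xs \<noteq> 1)
    \<and> (\<exists>W. crucial_subgraph UNIV E W \<and> disjoint_cycles_and_isolated W (ind W) (cyclomatic UNIV))"
proof (intro iffI conjI allI impI)
  assume t: "tight UNIV"
  show "cycles_vertex_disjoint E"
    unfolding cycles_vertex_disjoint_def
  proof (intro allI impI, rule ccontr)
    fix xs ys assume "is_cycle E xs" "is_cycle E ys" "cycle_edges xs \<noteq> cycle_edges ys"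
      "set xs \<inter> set ys \<noteq> {}"
    then show False using tight_cycle_unique(2)[OF t, of xs ys] by simp
  qed
  obtain W where W: "crucial_subgraph UNIV E W" "tight W" "cyclomatic W = cyclomatic UNIV"
    using tight_crucial_exists[OF t] by blast
  then have "\<not> (\<exists>x y. pendant_pair W x y)" by (simp add: crucial_subgraph_def pendant_vertex_iff)
  then have "disjoint_cycles_and_isolated W (ind W) (cyclomatic UNIV)"
    using tight_pendant_free_disjoint_cycles[OF W(2)] W(3) by simp
  then show "\<exists>W. crucial_subgraph UNIV E W \<and> disjoint_cycles_and_isolated W (ind W) (cyclomatic UNIV)"
    using W(1) by blast
  fix xs assume xs: "is_cycle E xs"
  then have "tight (set xs)" using tight_structure[OF t] by blast
  then have "4 dvd length xs \<and> cycle_weight H xs \<noteq> 1"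
    using tight_cycle_gap[OF xs] gap_cycle_eq_2_iff[OF xs tight_chordless[OF t xs subset_UNIV]] by blast
  then show "4 dvd length xs" "cycle_weight H xs \<noteq> 1" by blast+
next
  assume *: "cycles_vertex_disjoint E
    \<and> (\<forall>xs. is_cycle E xs \<longrightarrow> 4 dvd length xs \<and> cycle_weight H xs \<noteq> 1)
    \<and> (\<exists>W. crucial_subgraph UNIV E W \<and> disjoint_cycles_and_isolated W (ind W) (cyclomatic UNIV))"
  then obtain W where W: "crucial_subgraph UNIV E W"
    "disjoint_cycles_and_isolated W (ind W) (cyclomatic UNIV)" by blast
  obtain C I where C: "finite C" "int (card C) = cyclomatic UNIV" "\<forall>xs\<in>C. is_cycle (ind W) xs"
      "pairwise (\<lambda>xs ys. disjnt (set xs) (set ys)) C"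
      "disjnt (\<Union>(set ` C)) I" "W = \<Union>(set ` C) \<union> I" "ind W = \<Union>(cycle_edges ` C)"
    using W(2) unfolding disjoint_cycles_and_isolated_def by (elim exE conjE) (rule that)
  note g = gap_disjoint_cycles[OF C(1,3-7)]
  have "gap (set xs) = 2" if "xs \<in> C" for xs
  proof -
    have xs: "is_cycle E xs" using C(3) that by (simp add: is_cycle_induced_iff)
    then show ?thesis using gap_cycle_eq_2_iff[OF xs] g(2) that * by blast
  qed
  then have "gap W = 2 * cyclomatic UNIV" unfolding g(1) using C(2) by simp
  then show "tight UNIV" using gap_delta[of UNIV W] W(1) by (simp add: tight_def crucial_subgraph_def)
qed

end

section \<open>Powers of the imaginary unit and the signature\<close>

lemma i_power_eq_1_iff: "\<i> ^ n = 1 \<longleftrightarrow> 4 dvd n"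
proof -
  have "\<i> ^ n = \<i> ^ (4 * (n div 4) + n mod 4)" by simp
  also have "\<dots> = \<i> ^ (n mod 4)" unfolding power_add power_mult by simp
  finally have e: "\<i> ^ n = \<i> ^ (n mod 4)" .
  have "n mod 4 < 4" by simp
  then consider "n mod 4 = 0" | "n mod 4 = 1" | "n mod 4 = 2" | "n mod 4 = 3" by linarith
  then show ?thesis
    unfolding e dvd_eq_mod_eq_0 by cases (simp_all add: power3_eq_cube complex_eq_iff)
qed

text \<open>A forward and a backward factor multiply to 1, so only the excess of one kind counts; an
  excess of backward factors is reduced to the other case by complex conjugation.\<close>

lemma i_power_mult_eq_1_iff: "\<i> ^ f * (- \<i>) ^ b = 1 \<longleftrightarrow> 4 dvd nat \<bar>int f - int b\<bar>"
proof (cases "b \<le> f")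
  case True
  have "\<i> ^ f * (- \<i>) ^ b = \<i> ^ (f - b) * (\<i> * - \<i>) ^ b"
    unfolding power_mult_distrib using True by (simp flip: power_add mult.assoc)
  also have "\<dots> = \<i> ^ (f - b)" by simp
  finally show ?thesis using True by (simp add: i_power_eq_1_iff nat_diff_distrib flip: of_nat_diff)
next
  case False
  have "\<i> ^ f * (- \<i>) ^ b = (- \<i>) ^ (b - f) * (\<i> * - \<i>) ^ f"
    unfolding power_mult_distrib using False by (simp flip: power_add mult.assoc)
  also have "\<dots> = cnj (\<i> ^ (b - f))" by simp
  also have "\<dots> = 1 \<longleftrightarrow> \<i> ^ (b - f) = 1" by (simp add: complex_cnj_one_iff del: complex_cnj_power)
  finally show ?thesis using False by (simp add: i_power_eq_1_iff nat_diff_distrib flip: of_nat_diff)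
qed

lemma prod_indicator_power:
  fixes c :: "'a::comm_monoid_mult"
  assumes "finite S" shows "(\<Prod>j\<in>S. if P j then c else 1) = c ^ card {j\<in>S. P j}"
proof -
  have "{j\<in>S. P j} = S \<inter> {j. P j}" by blast
  then show ?thesis using assms by (simp add: prod.If_cases)
qed

theorem theorem1p2:
  fixes E :: "('v::finite) set set" and A :: "('v \<times> 'v) set"
  assumes "mixed_graph UNIV E A"
  shows "int (rank (hermitian_adjacency_matrix E A)) - int (rank (adjacency_matrix E))
           = 2 * cyclomatic_number UNIV E
     \<longleftrightarrow> cycles_vertex_disjoint E
       \<and> (\<forall>xs. is_cycle E xs \<longrightarrow>
            [length xs = 0] (mod 4) \<and> (odd (signature A xs) \<or> [signature A xs = 2] (mod 4)))
       \<and> (\<exists>W. crucial_subgraph UNIV E W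
            \<and> disjoint_cycles_and_isolated W (induced_edges E W) (cyclomatic_number UNIV E))"
proof -
  let ?H = "hermitian_adjacency_matrix E A"
  have card_E: "card e = 2" if "e \<in> E" for e
    using assms that by (auto simp: mixed_graph_def simple_graph_def)
  have arc: "{u, v} \<in> E \<and> (v, u) \<notin> A" if "(u, v) \<in> A" for u v
    using assms that by (auto simp: mixed_graph_def)
  have fg: "finite_graph E" by unfold_locales (rule card_E)
  have arc_rev: "{v, u} \<in> E" if "(u, v) \<in> A" for u v
    using arc[OF that] by (simp add: insert_commute)
  have "finite_graph.edge_weights E ?H"
    unfolding finite_graph.edge_weights_def[OF fg]
  proof (intro conjI allI impI)
    fix u v
    show "?H$u$v = 0" if "{u, v} \<notin> E"
      using that arc[of u v] arc_rev[of v u] by (auto simp: hermitian_adjacency_matrix_def)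
    show "?H$u$v * ?H$v$u = 1" if "{u, v} \<in> E"
      using that arc[of u v] arc[of v u] by (auto simp: hermitian_adjacency_matrix_def insert_commute)
  qed
  then interpret rank_gap E "adjacency_matrix E" ?H
    by (intro rank_gap.intro rank_gap_axioms.intro fg) (simp_all add: adjacency_matrix_def)
  have ind_UNIV: "ind UNIV = E" by (simp add: induced_edges_def)
  \<comment> \<open>Rank plus nullity is the order for both matrices, so the order cancels and the
    roles of the two matrices are exchanged in the difference.\<close>
  have "tight UNIV \<longleftrightarrow> int (rank ?H) - int (rank (adjacency_matrix E)) = 2 * cyclomatic_number UNIV E"
    using rank_plus_nullity[of ?H] rank_plus_nullity[of "adjacency_matrix E"]
    unfolding tight_def gap_def cyclomatic_def ind_UNIV by linarith
  moreover have "4 dvd length xs \<and> cycle_weight ?H xs \<noteq> 1 \<longleftrightarrow>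
      [length xs = 0] (mod 4) \<and> (odd (signature A xs) \<or> [signature A xs = 2] (mod 4))"
    if xs: "is_cycle E xs" for xs
  proof -
    let ?x = "cyc_nth xs"
    have ne: "xs \<noteq> []" and sub: "cycle_edges xs \<subseteq> E" using xs by (auto simp: is_cycle_def)
    have edge: "{?x j, ?x (Suc j)} \<in> E" for j using sub cycle_edges_eq[OF ne] by blast
    \<comment> \<open>An edge carries at most one arc, so at most one of the two factors differs
      from 1; separating them lets forward and backward arcs be counted independently.\<close>
    have "?H $ ?x j $ ?x (Suc j) = (if (?x j, ?x (Suc j)) \<in> A then \<i> else 1)
        * (if (?x (Suc j), ?x j) \<in> A then - \<i> else 1)" for j
      using edge[of j] arc[of "?x j" "?x (Suc j)"] by (simp add: hermitian_adjacency_matrix_def)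
    then have "cycle_weight ?H xs = \<i> ^ card {j\<in>{..<length xs}. (?x j, ?x (Suc j)) \<in> A}
        * (- \<i>) ^ card {j\<in>{..<length xs}. (?x (Suc j), ?x j) \<in> A}"
      by (simp add: cycle_weight_def prod.distrib prod_indicator_power)
    moreover have "{j\<in>{..<length xs}. (?x j, ?x (Suc j)) \<in> A} = {i. i < length xs \<and> (xs ! i, cycle_next xs i) \<in> A}"
      "{j\<in>{..<length xs}. (?x (Suc j), ?x j) \<in> A} = {i. i < length xs \<and> (cycle_next xs i, xs ! i) \<in> A}"
      by (auto simp: cyc_nth_def cycle_next_def)
    ultimately have "cycle_weight ?H xs = \<i> ^ forward_arcs A xs * (- \<i>) ^ backward_arcs A xs"
      by (simp add: forward_arcs_def backward_arcs_def)
    then have "cycle_weight ?H xs = 1 \<longleftrightarrow> 4 dvd signature A xs"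
      by (simp add: i_power_mult_eq_1_iff signature_def)
    \<comment> \<open>The nonzero residues modulo 4 are the odd ones and 2.\<close>
    moreover have "\<not> 4 dvd signature A xs \<longleftrightarrow> odd (signature A xs) \<or> [signature A xs = 2] (mod 4)"
      unfolding cong_def by presburger
    ultimately show ?thesis by (simp add: cong_0_iff)
  qed
  ultimately show ?thesis using tight_iff unfolding cyclomatic_def ind_UNIV by auto
qed

end
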